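(* Let $\zeta$ be a finite positive continuous measure on $SG$, let $m\ge0$, and let $E=\{x_1,\dots,x_n\}\subset V_m$ be a finite set of distinct points containing three points, which we label $x_1,x_2,x_3$, such that the $3\times3$ matrix $H=(h_{j}(x_i))_{1\le i\le 3,\ 0\le j\le 2}$ is invertible. Let $a_1,\dots,a_n\in\mathbb{R}$ and $$Y=\{u\in\operatorname{dom}_{L^2}\Delta_\zeta : u(x_i)=a_i\text{ for all }i\}.$$ Then there is a unique $u\in Y$ minimizing $T_\zeta(u)=\int_{SG}(\Delta_\zeta u)^2\,d\zeta$ over $Y$.
   Context: Let $q_0,q_1,q_2$ be the vertices of an equilateral triangle in the plane, $F_i(x)=\frac12(x+q_i)$, and let $SG$ (the Sierpinski gasket) be the unique nonempty compact set with $SG=\bigcup_{i}F_i(SG)$. For a word $w$ of length $m$ let $F_w=F_{w_1}\circ\cdots\circ F_{w_m}$; the sets $F_wSG$ are the cells. Put $V_0=\{q_0,q_1,q_2\}$, $V_m=\bigcup_iF_iV_{m-1}$; $x\sim_m y$ means $x\ne y$ and $x,y\in F_wV_0$ for some word $w$ of length $m$. The energy of a continuous $u:SG\to\mathbb{R}$ is $\mathcal{E}(u)=\lim_{m\to\infty}\left(\frac53\right)^m\sum_{\{x,y\}:x\sim_m y}(u(x)-u(y))^2$ (a nondecreasing limit), $\operatorname{dom}\mathcal{E}$ is the set of continuous $u$ with $\mathcal{E}(u)<\infty$, and $\mathcal{E}(u,v)$ is the associated bilinear form. $h_j$ is the harmonic function with $h_j(q_i)=\delta_{ij}$, i.e.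 the unique function of least energy with these values on $V_0$. A finite positive continuous measure on $SG$ is a finite Borel measure with no atoms giving positive mass to every cell. $\operatorname{dom}_{L^2}\Delta_\zeta$ is the set of $u\in\operatorname{dom}\mathcal{E}$ for which there is $f\in L^2(\zeta)$ with $\mathcal{E}(u,v)=-\int fv\,d\zeta$ for all $v\in\operatorname{dom}\mathcal{E}$ with $v|_{V_0}=0$; then $\Delta_\zeta u:=f$. *)

theory Defs
  imports "HOL-Analysis.Analysis"
begin

text \<open>
  The triangle is a parameter \<open>q\<close>; only \<open>q 0\<close>, \<open>q 1\<close>, \<open>q 2\<close> matter. Words are lists over
  \<open>{..<3}\<close>. A real function on the gasket is represented by a function on the plane that is
  \<open>undefined\<close> off the gasket (\<^const>\<open>extensional\<close>), so that equality of representatives is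
  equality on the gasket.
\<close>

definition equilateral :: "(nat \<Rightarrow> real^2) \<Rightarrow> bool" where
  "equilateral q \<longleftrightarrow> q 0 \<noteq> q 1 \<and> dist (q 0) (q 1) = dist (q 1) (q 2)
     \<and> dist (q 1) (q 2) = dist (q 2) (q 0)"

definition sg_map :: "(nat \<Rightarrow> real^2) \<Rightarrow> nat \<Rightarrow> real^2 \<Rightarrow> real^2" where
  "sg_map q i x = (1/2) *\<^sub>R (x + q i)"

definition SG :: "(nat \<Rightarrow> real^2) \<Rightarrow> (real^2) set" where
  "SG q = (THE K. K \<noteq> {} \<and> compact K \<and> K = (\<Union>i<3. sg_map q i ` K))"

definition sg_words :: "nat \<Rightarrow> nat list set" where
  "sg_words m = {w. length w = m \<and> set w \<subseteq> {..<3}}"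

primrec sg_word_map :: "(nat \<Rightarrow> real^2) \<Rightarrow> nat list \<Rightarrow> real^2 \<Rightarrow> real^2" where
  "sg_word_map q [] = id"
| "sg_word_map q (i # w) = sg_map q i \<circ> sg_word_map q w"

primrec sg_V :: "(nat \<Rightarrow> real^2) \<Rightarrow> nat \<Rightarrow> (real^2) set" where
  "sg_V q 0 = q ` {..<3}"
| "sg_V q (Suc m) = (\<Union>i<3. sg_map q i ` sg_V q m)"

definition sg_adj :: "(nat \<Rightarrow> real^2) \<Rightarrow> nat \<Rightarrow> real^2 \<Rightarrow> real^2 \<Rightarrow> bool" where
  "sg_adj q m x y \<longleftrightarrow> x \<noteq> y \<and>
     (\<exists>w\<in>sg_words m. x \<in> sg_word_map q w ` sg_V q 0 \<and> y \<in> sg_word_map q w ` sg_V q 0)"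

text \<open>The factor 1/2 compensates for summing over ordered pairs instead of unordered ones.\<close>

definition graph_energy :: "(nat \<Rightarrow> real^2) \<Rightarrow> nat \<Rightarrow> (real^2 \<Rightarrow> real) \<Rightarrow> real" where
  "graph_energy q m u =
     (5/3)^m * (1/2 * (\<Sum>(x, y) \<in> {(x, y). sg_adj q m x y}. (u x - u y)^2))"

definition energy :: "(nat \<Rightarrow> real^2) \<Rightarrow> (real^2 \<Rightarrow> real) \<Rightarrow> ennreal" where
  "energy q u = lim (\<lambda>m. ennreal (graph_energy q m u))"

definition dom_energy :: "(nat \<Rightarrow> real^2) \<Rightarrow> (real^2 \<Rightarrow> real) set" where
  "dom_energy q = {u \<in> extensional (SG q). continuous_on (SG q) u \<and> energy q u < \<infinity>}"

text \<open>
  Polarization. The sum and difference are not \<open>undefined\<close> off the gasket, which is harmless: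
  the energy only sees the values on the vertex sets.
\<close>

definition energy_form :: "(nat \<Rightarrow> real^2) \<Rightarrow> (real^2 \<Rightarrow> real) \<Rightarrow> (real^2 \<Rightarrow> real) \<Rightarrow> real" where
  "energy_form q u v =
     (enn2real (energy q (\<lambda>x. u x + v x)) - enn2real (energy q (\<lambda>x. u x - v x))) / 4"

definition harmonic_candidates :: "(nat \<Rightarrow> real^2) \<Rightarrow> nat \<Rightarrow> (real^2 \<Rightarrow> real) set" where
  "harmonic_candidates q j =
     {u \<in> dom_energy q. \<forall>i<3. u (q i) = (if i = j then 1 else 0)}"

definition harmonic_basis :: "(nat \<Rightarrow> real^2) \<Rightarrow> nat \<Rightarrow> real^2 \<Rightarrow> real" where
  "harmonic_basis q j =
     (THE h. h \<in> harmonic_candidates q j \<and>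
        (\<forall>u\<in>harmonic_candidates q j. energy q h \<le> energy q u))"

definition finite_positive_continuous_measure ::
    "(nat \<Rightarrow> real^2) \<Rightarrow> (real^2) measure \<Rightarrow> bool" where
  "finite_positive_continuous_measure q \<zeta> \<longleftrightarrow>
     sets \<zeta> = sets (restrict_space borel (SG q)) \<and> finite_measure \<zeta> \<and>
     (\<forall>x\<in>SG q. emeasure \<zeta> {x} = 0) \<and>
     (\<forall>m. \<forall>w\<in>sg_words m. emeasure \<zeta> (sg_word_map q w ` SG q) > 0)"

text \<open>
  \<open>has_laplacian q \<zeta> u f\<close>: the square-integrable function \<open>f\<close> represents the Laplacian of \<open>u\<close>,
  which is an element of \<open>L\<^sup>2(\<zeta>)\<close> and hence determined only almost everywhere; \<open>laplacian\<close>
  picks a representative.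
\<close>

definition has_laplacian ::
    "(nat \<Rightarrow> real^2) \<Rightarrow> (real^2) measure \<Rightarrow> (real^2 \<Rightarrow> real) \<Rightarrow> (real^2 \<Rightarrow> real) \<Rightarrow> bool" where
  "has_laplacian q \<zeta> u f \<longleftrightarrow>
     f \<in> borel_measurable \<zeta> \<and> integrable \<zeta> (\<lambda>x. (f x)^2) \<and>
     (\<forall>v\<in>dom_energy q. (\<forall>x\<in>sg_V q 0. v x = 0) \<longrightarrow>
        energy_form q u v = - (\<integral>x. f x * v x \<partial>\<zeta>))"

definition dom_laplacian ::
    "(nat \<Rightarrow> real^2) \<Rightarrow> (real^2) measure \<Rightarrow> (real^2 \<Rightarrow> real) set" where
  "dom_laplacian q \<zeta> = {u \<in> dom_energy q. \<exists>f. has_laplacian q \<zeta> u f}"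

definition laplacian ::
    "(nat \<Rightarrow> real^2) \<Rightarrow> (real^2) measure \<Rightarrow> (real^2 \<Rightarrow> real) \<Rightarrow> real^2 \<Rightarrow> real" where
  "laplacian q \<zeta> u = (SOME f. has_laplacian q \<zeta> u f)"

definition spline_functional ::
    "(nat \<Rightarrow> real^2) \<Rightarrow> (real^2) measure \<Rightarrow> (real^2 \<Rightarrow> real) \<Rightarrow> real" where
  "spline_functional q \<zeta> u = (\<integral>x. (laplacian q \<zeta> u x)^2 \<partial>\<zeta>)"

definition interpolants ::
    "(nat \<Rightarrow> real^2) \<Rightarrow> (real^2) measure \<Rightarrow> nat \<Rightarrow> (nat \<Rightarrow> real^2) \<Rightarrow> (nat \<Rightarrow> real) \<Rightarrow> (real^2 \<Rightarrow> real) set"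
  where
  "interpolants q \<zeta> n x a = {u \<in> dom_laplacian q \<zeta>. \<forall>i\<in>{1..n}. u (x i) = a i}"

definition harmonic_matrix :: "(nat \<Rightarrow> real^2) \<Rightarrow> (nat \<Rightarrow> real^2) \<Rightarrow> real^3^3" where
  "harmonic_matrix q x = vector
     [vector [harmonic_basis q 0 (x 1), harmonic_basis q 1 (x 1), harmonic_basis q 2 (x 1)],
      vector [harmonic_basis q 0 (x 2), harmonic_basis q 1 (x 2), harmonic_basis q 2 (x 2)],
      vector [harmonic_basis q 0 (x 3), harmonic_basis q 1 (x 3), harmonic_basis q 2 (x 3)]]"

end

theory Submission
  imports Defs
begin

text \<open>
  Write \<open>W0\<close> for the finite-energy functions vanishing on \<open>V 0\<close>. Since the oscillation of \<open>u\<close> is at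
  most a constant times the square root of its energy, \<open>W0\<close> is complete in the energy norm and point
  evaluations are bounded; let \<open>g\<^sub>p\<close> represent the evaluation at \<open>p\<close>. A spline is a \<open>u\<close> whose
  Laplacian is \<open>f = (\<Sum>p\<in>E. \<beta> p * g\<^sub>p)\<close> with \<open>\<Sum>p\<in>E. \<beta> p * h\<^sub>j p = 0\<close> for every \<open>j\<close>. The side condition
  makes \<open>f\<close> orthogonal in \<open>L\<^sup>2(\<zeta>)\<close> to the Laplacian of every function that vanishes on \<open>E\<close>, so a
  spline with the prescribed values minimizes, and the minimizer is unique up to a harmonic function
  vanishing on \<open>E\<close>, which is zero because \<open>H\<close> is invertible. That splines attain all values on \<open>E\<close> is
  finite-dimensional duality: if \<open>\<gamma>\<close> annihilates their values, then evaluating \<open>\<gamma>\<close> on the spline with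
  \<open>\<beta> = \<gamma>\<close> gives \<open>\<integral> f\<^sup>2 d\<zeta> = 0\<close>, whence \<open>\<gamma> = 0\<close>. In particular no completeness of \<open>L\<^sup>2(\<zeta>)\<close> is needed.
\<close>

section \<open>The gasket\<close>

text \<open>\<open>laplacian\<close> is a choice among functions that agree almost everywhere. The
  minimized integral can therefore be computed from a known representative only once a
  square-integrable function orthogonal to \<open>W0\<close> is known to vanish almost everywhere.
  Members of \<open>W0\<close> vanish on \<open>V 0\<close>, and absence of atoms makes this
  harmless. Positive mass of every cell turns a zero integral of \<open>f\<close> squared into
  \<open>f = 0\<close> at every point of the gasket. From \<open>f = 0\<close> one still has to
  reach \<open>\<gamma> = 0\<close>. A point of \<open>E\<close> in \<open>V 0\<close> has a
  representer that is zero on the gasket, so \<open>f\<close> does not see it. Its coefficient is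
  recovered from the side condition, which \<gamma> satisfies because harmonic functions are
  themselves splines, with \<open>\<beta> = 0\<close>. At the remaining points a finite-energy
  function with prescribed values on \<open>V m\<close> is needed. Such functions are built
  explicitly, by the harmonic subdivision rule and gluing along cells. Being constant on cells with
  constant corner values, they also approximate indicators of closed sets.\<close>

lemma sg_map_dist: "dist (sg_map q i x) (sg_map q i y) = dist x y / 2"
  by (simp add: sg_map_def dist_norm flip: scaleR_diff_right)

lemma sg_map_eq_iff [simp]: "sg_map q i x = sg_map q i y \<longleftrightarrow> x = y"
  by (simp add: sg_map_def)

lemma sg_map_fixpoint [simp]: "sg_map q i (q i) = q i"
  by (simp add: sg_map_def flip: scaleR_2)

lemma continuous_on_sg_map: "continuous_on S (sg_map q i)"
  unfolding sg_map_def by (intro continuous_intros)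

lemma lessThan_3: "{..<3::nat} = {0, 1, 2}"
  by auto

text \<open>A point of \<open>K\<close> farthest from \<open>K'\<close> is the image of another
  point of \<open>K\<close>. The map halves distances and sends \<open>K'\<close> into itself, so
  the largest distance is at most half of itself. Used in both directions this gives uniqueness of
  the invariant set.\<close>

lemma sg_invariant_subset:
  assumes K: "K \<noteq> {}" "compact K" "K = (\<Union>i<3. sg_map q i ` K)"
    and K': "K' \<noteq> {}" "compact K'" "K' = (\<Union>i<3. sg_map q i ` K')"
  shows "K \<subseteq> K'"
proof -
  have cont: "continuous_on K (\<lambda>x. infdist x K')"
    by (intro continuous_intros)
  obtain x where x: "x \<in> K" "\<And>y. y \<in> K \<Longrightarrow> infdist y K' \<le> infdist x K'"
    using continuous_attains_sup[OF K(2,1) cont] by blast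
  obtain i y where iy: "i < 3" "y \<in> K" "x = sg_map q i y"
    using x(1) K(3) by blast
  obtain z where z: "z \<in> K'" "infdist y K' = dist y z"
    using infdist_attains_inf[OF compact_imp_closed[OF K'(2)] K'(1)] by blast
  have "sg_map q i z \<in> K'"
    using K'(3) iy(1) z(1) by blast
  then have "infdist x K' \<le> dist (sg_map q i y) (sg_map q i z)"
    unfolding iy(3) by (rule infdist_le)
  also have "\<dots> \<le> infdist x K' / 2"
    using x(2)[OF iy(2)] z(2) by (simp add: sg_map_dist)
  finally have "infdist x K' \<le> 0" by simp
  then have "infdist y K' = 0" if "y \<in> K" for y
    using x(2)[OF that] infdist_nonneg[of y K'] by linarith
  then show ?thesis
    using in_closed_iff_infdist_zero[OF compact_imp_closed[OF K'(2)] K'(1)] by blast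
qed

lemma sg_V_subset_hull: "sg_V q m \<subseteq> convex hull (q ` {..<3})"
proof (induction m)
  case 0
  show ?case by (simp add: hull_subset)
next
  case (Suc m)
  have "sg_map q i x \<in> convex hull (q ` {..<3})" if "i < 3" "x \<in> sg_V q m" for i x
  proof -
    have "q i \<in> convex hull (q ` {..<3})" using that(1) by (intro hull_inc) auto
    moreover have "x \<in> convex hull (q ` {..<3})" using Suc that(2) by blast
    ultimately show ?thesis
      using convexD[OF convex_convex_hull, of x "q ` {..<3}" "q i" "1/2" "1/2"]
      by (simp add: sg_map_def scaleR_add_right)
  qed
  then show ?case by auto
qed

lemma sg_V_mono_Suc: "sg_V q m \<subseteq> sg_V q (Suc m)"
proof (induction m)
  case 0
  show ?case
  proof
    fix x assume "x \<in> sg_V q 0"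
    then obtain i where "i < 3" "x = q i" by auto
    then have "x \<in> sg_map q i ` sg_V q 0"
      by (intro image_eqI[of _ _ "q i"]) auto
    then show "x \<in> sg_V q (Suc 0)" using \<open>i < 3\<close> by auto
  qed
next
  case (Suc m)
  then show ?case by fastforce
qed

lemma sg_V_mono: "m \<le> n \<Longrightarrow> sg_V q m \<subseteq> sg_V q n"
  by (rule lift_Suc_mono_le[of "sg_V q"]) (simp_all only: sg_V_mono_Suc)

lemma vertex_in_sg_V: "i < 3 \<Longrightarrow> q i \<in> sg_V q m"
  using sg_V_mono[of 0 m q] by auto

lemma finite_sg_V: "finite (sg_V q m)"
  by (induction m) auto

text \<open>The union of the vertex sets is itself invariant. Invariance survives the closure
  because the three images of a compact set have a closed union.\<close>

lemma closure_sg_V_invariant: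
  fixes q :: "nat \<Rightarrow> real^2"
  defines "W \<equiv> \<Union>m. sg_V q m"
  shows "closure W \<noteq> {}" "compact (closure W)"
    "closure W = (\<Union>i<3. sg_map q i ` closure W)"
proof -
  have W: "W = (\<Union>i<3. sg_map q i ` W)"
  proof
    show "W \<subseteq> (\<Union>i<3. sg_map q i ` W)"
    proof
      fix x assume "x \<in> W"
      then obtain m where "x \<in> sg_V q m" unfolding W_def by blast
      then have "x \<in> sg_V q (Suc m)" using sg_V_mono_Suc by blast
      then show "x \<in> (\<Union>i<3. sg_map q i ` W)" unfolding W_def by auto
    qed
    show "(\<Union>i<3. sg_map q i ` W) \<subseteq> W"
    proof
      fix x assume "x \<in> (\<Union>i<3. sg_map q i ` W)"
      then obtain i m y where "i < 3" "y \<in> sg_V q m" "x = sg_map q i y"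
        unfolding W_def by blast
      then have "x \<in> sg_V q (Suc m)" by auto
      then show "x \<in> W" unfolding W_def by blast
    qed
  qed
  have "q 0 \<in> sg_V q 0" by simp
  then have "q 0 \<in> W" unfolding W_def by blast
  then show "closure W \<noteq> {}" by auto
  have "W \<subseteq> convex hull (q ` {..<3})" unfolding W_def using sg_V_subset_hull by blast
  moreover have "compact (convex hull (q ` {..<3}))"
    by (intro compact_convex_hull finite_imp_compact) auto
  ultimately show comp: "compact (closure W)"
    by (meson bounded_subset compact_imp_bounded compact_closure)
  show "closure W = (\<Union>i<3. sg_map q i ` closure W)"
  proof
    have "closed (\<Union>i<3. sg_map q i ` closure W)"
      by (intro closed_UN ballI compact_imp_closed compact_continuous_image
          continuous_on_sg_map comp) auto
    moreover have "W \<subseteq> (\<Union>i<3. sg_map q i ` closure W)"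
      using W closure_subset[of W] by (metis (no_types, lifting) UN_mono image_mono order_refl)
    ultimately show "closure W \<subseteq> (\<Union>i<3. sg_map q i ` closure W)"
      by (rule closure_minimal[rotated])
    have "sg_map q i ` closure W \<subseteq> closure W" if "i < 3" for i
    proof (rule image_closure_subset)
      show "continuous_on (closure W) (sg_map q i)" by (rule continuous_on_sg_map)
      show "sg_map q i ` W \<subseteq> closure W"
        using W that closure_subset[of W] by blast
    qed auto
    then show "(\<Union>i<3. sg_map q i ` closure W) \<subseteq> closure W" by blast
  qed
qed

text \<open>Besides resolving the definite description, this records that the vertices are dense, so
  bounds on vertices extend to the gasket by continuity.\<close>

lemma SG_eq_closure: "SG q = closure (\<Union>m. sg_V q m)"
  unfolding SG_def
proof (rule the_equality)
  show "closure (\<Union>m. sg_V q m) \<noteq> {} \<and> compact (closure (\<Union>m. sg_V q m)) \<and>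
    closure (\<Union>m. sg_V q m) = (\<Union>i<3. sg_map q i ` closure (\<Union>m. sg_V q m))"
    using closure_sg_V_invariant[of q] by blast
  fix K assume "K \<noteq> {} \<and> compact K \<and> K = (\<Union>i<3. sg_map q i ` K)"
  then show "K = closure (\<Union>m. sg_V q m)"
    using sg_invariant_subset[of K q "closure (\<Union>m. sg_V q m)"]
      sg_invariant_subset[of "closure (\<Union>m. sg_V q m)" q K] closure_sg_V_invariant[of q]
    by (intro equalityI) blast+
qed

lemma compact_SG: "compact (SG q)" and SG_fixed: "SG q = (\<Union>i<3. sg_map q i ` SG q)"
  unfolding SG_eq_closure using closure_sg_V_invariant[of q] by blast+

lemma closed_SG: "closed (SG q)"
  by (simp add: compact_SG compact_imp_closed)

lemma sg_V_subset_SG: "sg_V q m \<subseteq> SG q"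
  unfolding SG_eq_closure using closure_subset[of "\<Union>m. sg_V q m"] by blast

lemma vertex_in_SG: "i < 3 \<Longrightarrow> q i \<in> SG q"
  using sg_V_subset_SG[of q 0] by auto

lemma SG_subset_hull: "SG q \<subseteq> convex hull (q ` {..<3})"
  unfolding SG_eq_closure
  by (intro closure_minimal UN_least sg_V_subset_hull compact_imp_closed compact_convex_hull
      finite_imp_compact) auto

lemma sg_map_in_SG: "i < 3 \<Longrightarrow> x \<in> SG q \<Longrightarrow> sg_map q i x \<in> SG q"
  using SG_fixed[of q] by blast

lemma sg_map_in_SG_cases:
  assumes "x \<in> SG q" obtains i y where "i < 3" "y \<in> SG q" "x = sg_map q i y"
  using SG_fixed[of q] assms by blast

section \<open>Words and cells\<close>

lemma sg_words_0 [simp]: "sg_words 0 = {[]}"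
  by (auto simp: sg_words_def)

lemma sg_words_Suc: "sg_words (Suc m) = {i # w | i w. i < 3 \<and> w \<in> sg_words m}"
  by (auto simp: sg_words_def length_Suc_conv)

lemma sg_word_map_V0_subset: "w \<in> sg_words m \<Longrightarrow> sg_word_map q w ` sg_V q 0 \<subseteq> sg_V q m"
proof (induction m arbitrary: w)
  case (Suc m)
  then obtain i v where "w = i # v" "i < 3" "v \<in> sg_words m" by (auto simp: sg_words_Suc)
  then show ?case using Suc.IH[of v] by (force simp: image_comp[symmetric])
qed auto

lemma sg_word_map_SG_subset: "w \<in> sg_words m \<Longrightarrow> sg_word_map q w ` SG q \<subseteq> SG q"
proof (induction m arbitrary: w)
  case (Suc m)
  then obtain i v where "w = i # v" "i < 3" "v \<in> sg_words m" by (auto simp: sg_words_Suc)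
  then show ?case using Suc.IH[of v] sg_map_in_SG[of i _ q] by force
qed auto

lemma continuous_on_sg_word_map: "continuous_on S (sg_word_map q w)"
proof (induction w)
  case (Cons i w)
  show ?case
    unfolding sg_word_map.simps by (intro continuous_on_compose Cons continuous_on_sg_map)
qed (auto intro: continuous_on_id)

lemma sg_word_map_dist:
  "w \<in> sg_words m \<Longrightarrow> dist (sg_word_map q w x) (sg_word_map q w y) = dist x y / 2 ^ m"
proof (induction m arbitrary: w)
  case (Suc m)
  then obtain i v where "w = i # v" "v \<in> sg_words m" by (auto simp: sg_words_Suc)
  then show ?case using Suc.IH[of v] by (simp add: sg_map_dist)
qed auto

lemma SG_cell_cover:
  "x \<in> SG q \<Longrightarrow> \<exists>w\<in>sg_words m. x \<in> sg_word_map q w ` SG q"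
proof (induction m arbitrary: x)
  case (Suc m)
  obtain i y where iy: "i < 3" "y \<in> SG q" "x = sg_map q i y"
    using sg_map_in_SG_cases[OF Suc.prems] .
  obtain w where "w \<in> sg_words m" "y \<in> sg_word_map q w ` SG q"
    using Suc.IH[OF iy(2)] by blast
  then have "i # w \<in> sg_words (Suc m)" "x \<in> sg_word_map q (i # w) ` SG q"
    using iy by (auto simp: sg_words_Suc)
  then show ?case by blast
qed auto

section \<open>Geometry of the equilateral triangle\<close>

locale gasket =
  fixes q :: "nat \<Rightarrow> real^2"
  assumes equilateral: "equilateral q"
begin

abbreviation "F \<equiv> sg_map q"
abbreviation "K \<equiv> SG q"
abbreviation "V \<equiv> sg_V q"

definition side :: real where "side = dist (q 0) (q 1)"

lemma side_pos: "side > 0"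
  using equilateral unfolding equilateral_def side_def by (metis zero_less_dist_iff)

lemma dist_vertices: "i < 3 \<Longrightarrow> j < 3 \<Longrightarrow> i \<noteq> j \<Longrightarrow> dist (q i) (q j) = side"
  using equilateral unfolding equilateral_def side_def less_Suc_eq numeral_3_eq_3 numeral_2_eq_2
  by (elim disjE) (simp_all add: dist_commute)

lemma vertices_eq_iff: "i < 3 \<Longrightarrow> j < 3 \<Longrightarrow> q i = q j \<longleftrightarrow> i = j"
  using dist_vertices[of i j] side_pos by (cases "i = j") auto

lemma inner_vertices:
  assumes "i < 3" "j < 3" "k < 3" "i \<noteq> j" "i \<noteq> k" "j \<noteq> k"
  shows "(q k - q i) \<bullet> (q j - q i) = side\<^sup>2 / 2"
proof -
  have "(dist (q k) (q j))\<^sup>2 = (dist (q k) (q i))\<^sup>2 + (dist (q j) (q i))\<^sup>2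
      - 2 * ((q k - q i) \<bullet> (q j - q i))"
    unfolding dist_norm power2_norm_eq_inner
    by (simp add: inner_diff_left inner_diff_right inner_commute)
  then show ?thesis using assms by (simp add: dist_vertices)
qed

text \<open>The linear functional \<open>x \<mapsto> (x - q i) \<bullet> (q j - q i)\<close> attains its minimum \<open>0\<close> and its
  maximum \<open>side\<^sup>2\<close> over the triangle only at \<open>q i\<close> and \<open>q j\<close>.\<close>

lemma cells_touch:
  assumes ij: "i < 3" "j < 3" "i \<noteq> j" and xy: "x \<in> K" "y \<in> K" and eq: "F i x = F j y"
  shows "x = q j \<and> y = q i"
proof -
  obtain k where k: "k < 3" "i \<noteq> k" "j \<noteq> k" and ijk: "{..<3} = {i, j, k}"
  proof
    \<comment> \<open>The three indices sum to 3, so this is the remaining one.\<close>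
    show "3 - i - j < 3" "i \<noteq> 3 - i - j" "j \<noteq> 3 - i - j" "{..<3} = {i, j, 3 - i - j}"
      using ij by (auto simp: less_Suc_eq numeral_3_eq_3)
  qed
  define \<phi> where "\<phi> z = (z - q i) \<bullet> (q j - q i)" for z
  have \<phi>j: "(q j - q i) \<bullet> (q j - q i) = side\<^sup>2"
    using ij dist_vertices[of j i] by (simp add: dist_norm flip: power2_norm_eq_inner)
  have hull: "\<exists>a b c. 0 \<le> a \<and> 0 \<le> b \<and> 0 \<le> c \<and> a + b + c = 1 \<and>
      z = a *\<^sub>R q i + b *\<^sub>R q j + c *\<^sub>R q k \<and> \<phi> z = (b + c / 2) * side\<^sup>2" if z: "z \<in> K" for z
  proof -
    have "z \<in> convex hull {q i, q j, q k}" using z SG_subset_hull[of q] ijk by auto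
    then obtain a b c where abc: "0 \<le> a" "0 \<le> b" "0 \<le> c" "a + b + c = 1"
      "z = a *\<^sub>R q i + b *\<^sub>R q j + c *\<^sub>R q k"
      unfolding convex_hull_3 by blast
    have a: "a = 1 - b - c" using abc(4) by simp
    have "z - q i = b *\<^sub>R (q j - q i) + c *\<^sub>R (q k - q i)"
      unfolding abc(5) a by (simp add: algebra_simps)
    then have "\<phi> z = b * ((q j - q i) \<bullet> (q j - q i)) + c * ((q k - q i) \<bullet> (q j - q i))"
      unfolding \<phi>_def by (simp add: inner_add_left)
    also have "\<dots> = (b + c / 2) * side\<^sup>2"
      unfolding \<phi>j inner_vertices[OF ij(1,2) k(1) ij(3) k(2,3)] by (simp add: algebra_simps)
    finally show ?thesis using abc by blast
  qed
  obtain a b c where x: "0 \<le> a" "0 \<le> b" "0 \<le> c" "a + b + c = 1"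
      "x = a *\<^sub>R q i + b *\<^sub>R q j + c *\<^sub>R q k" "\<phi> x = (b + c / 2) * side\<^sup>2"
    using hull[OF xy(1)] by blast
  obtain a' b' c' where y: "0 \<le> a'" "0 \<le> b'" "0 \<le> c'" "a' + b' + c' = 1"
      "y = a' *\<^sub>R q i + b' *\<^sub>R q j + c' *\<^sub>R q k" "\<phi> y = (b' + c' / 2) * side\<^sup>2"
    using hull[OF xy(2)] by blast
  have "x + q i = y + q j" using eq by (simp add: sg_map_def)
  then have "x - y = q j - q i" by (simp add: algebra_simps)
  \<comment> \<open>The difference is the whole range of \<open>\<phi>\<close>, so \<open>x\<close>
    is where it is largest and \<open>y\<close> where it is smallest.\<close>
  then have "\<phi> x - \<phi> y = side\<^sup>2"
    unfolding \<phi>_def \<phi>j[symmetric] by (metis diff_diff_eq2 diff_add_cancel inner_diff_left)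
  then have "((b + c / 2) - (b' + c' / 2)) * side\<^sup>2 = side\<^sup>2"
    unfolding x(6) y(6) by (simp add: algebra_simps)
  then have "(b + c / 2) - (b' + c' / 2) = 1" using side_pos by simp
  then have "b = 1" "a = 0" "c = 0" "a' = 1" "b' = 0" "c' = 0"
    using x(1-4) y(1-4) by linarith+
  then show ?thesis using x(5) y(5) by simp
qed

text \<open>Both sides are the midpoint of \<open>q i\<close> and \<open>q j\<close>, the junction
  of two cells. The gluing conditions rest on this identity.\<close>

lemma sg_map_vertex_commute: "F i (q j) = F j (q i)"
  by (simp add: sg_map_def add.commute)

end

section \<open>Graph energies\<close>

text \<open>A real-valued form of finite energy, free of \<open>ennreal\<close> and limits. Its
  equivalence with \<open>energy q u < \<infinity>\<close> needs monotonicity and is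
  \<open>energy_finite_iff\<close>.\<close>

definition energy_bounded :: "(nat \<Rightarrow> real^2) \<Rightarrow> (real^2 \<Rightarrow> real) \<Rightarrow> bool" where
  "energy_bounded q u \<longleftrightarrow> (\<exists>M. \<forall>m. graph_energy q m u \<le> M)"

text \<open>Bilinearity and the Cauchy-Schwarz inequality are elementary at a finite level and pass
  to the limit, whereas \<open>energy_form\<close>, given by polarization, does not display
  them.\<close>

definition graph_form :: "(nat \<Rightarrow> real^2) \<Rightarrow> nat \<Rightarrow> (real^2 \<Rightarrow> real) \<Rightarrow> (real^2 \<Rightarrow> real) \<Rightarrow> real" where
  "graph_form q m u v =
     (5/3)^m * (1/2 * (\<Sum>(x, y) \<in> {(x, y). sg_adj q m x y}. (u x - u y) * (v x - v y)))"

definition real_energy :: "(nat \<Rightarrow> real^2) \<Rightarrow> (real^2 \<Rightarrow> real) \<Rightarrow> real" where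
  "real_energy q u = lim (\<lambda>m. graph_energy q m u)"

lemma sg_adj_Suc:
  "sg_adj q (Suc m) x y \<longleftrightarrow> (\<exists>i<3. \<exists>x' y'. x = sg_map q i x' \<and> y = sg_map q i y' \<and> sg_adj q m x' y')"
  (is "?L \<longleftrightarrow> ?R")
proof
  assume ?L
  then obtain i w where iw: "x \<noteq> y" "i < 3" "w \<in> sg_words m"
    "x \<in> (sg_map q i \<circ> sg_word_map q w) ` sg_V q 0"
    "y \<in> (sg_map q i \<circ> sg_word_map q w) ` sg_V q 0"
    unfolding sg_adj_def sg_words_Suc by auto
  then obtain x' y' where "x = sg_map q i x'" "y = sg_map q i y'"
    "x' \<in> sg_word_map q w ` sg_V q 0" "y' \<in> sg_word_map q w ` sg_V q 0"
    unfolding image_comp[symmetric] by blast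
  moreover from this iw(1) have "x' \<noteq> y'" by blast
  ultimately show ?R using iw(2,3) unfolding sg_adj_def by blast
next
  assume ?R
  then obtain i x' y' w where w: "i < 3" "x = sg_map q i x'" "y = sg_map q i y'" "x' \<noteq> y'"
    "w \<in> sg_words m" "x' \<in> sg_word_map q w ` sg_V q 0" "y' \<in> sg_word_map q w ` sg_V q 0"
    unfolding sg_adj_def by blast
  then have "i # w \<in> sg_words (Suc m)" "x \<noteq> y" unfolding sg_words_Suc by simp_all
  moreover have "x \<in> sg_word_map q (i # w) ` sg_V q 0" "y \<in> sg_word_map q (i # w) ` sg_V q 0"
    using w(2,3,6,7) by (simp_all only: sg_word_map.simps image_comp[symmetric] imageI)
  ultimately show ?L
    unfolding sg_adj_def by blast
qed

lemma sg_adj_in_V: "sg_adj q m x y \<Longrightarrow> x \<in> sg_V q m \<and> y \<in> sg_V q m"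
  unfolding sg_adj_def using sg_word_map_V0_subset[of _ m q] by blast

lemma finite_sg_adj: "finite {(x, y). sg_adj q m x y}"
  by (rule finite_subset[of _ "sg_V q m \<times> sg_V q m"]) (auto simp: finite_sg_V dest: sg_adj_in_V)

lemma graph_energy_nonneg: "graph_energy q m u \<ge> 0"
  unfolding graph_energy_def by (auto intro!: mult_nonneg_nonneg sum_nonneg)

lemma graph_energy_cong:
  "(\<And>x. x \<in> sg_V q m \<Longrightarrow> u x = v x) \<Longrightarrow> graph_energy q m u = graph_energy q m v"
  unfolding graph_energy_def
  by (auto intro!: sum.cong arg_cong2[where f = "(*)"] dest: sg_adj_in_V)

lemma graph_form_self: "graph_form q m u u = graph_energy q m u"
  by (simp add: graph_form_def graph_energy_def power2_eq_square)

lemma graph_form_commute: "graph_form q m u v = graph_form q m v u"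
  by (simp add: graph_form_def mult.commute)

lemma graph_form_add_left:
  "graph_form q m (\<lambda>x. u x + v x) w = graph_form q m u w + graph_form q m v w"
  unfolding graph_form_def sum.distrib[symmetric] distrib_left[symmetric]
  by (intro arg_cong2[where f = "(*)"] refl sum.cong) (auto simp: algebra_simps)

lemma graph_form_scale_left: "graph_form q m (\<lambda>x. c * u x) w = c * graph_form q m u w"
proof -
  have "(\<Sum>(x, y)\<in>A. (c * u x - c * u y) * (w x - w y)) = c * (\<Sum>(x, y)\<in>A. (u x - u y) * (w x - w y))"
    for A by (subst sum_distrib_left) (auto intro!: sum.cong simp: algebra_simps)
  then show ?thesis by (simp add: graph_form_def)
qed

lemma graph_form_add_right:
  "graph_form q m w (\<lambda>x. u x + v x) = graph_form q m w u + graph_form q m w v"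
  by (simp add: graph_form_commute[of q m w] graph_form_add_left)

lemma graph_form_scale_right: "graph_form q m w (\<lambda>x. c * u x) = c * graph_form q m w u"
  by (simp add: graph_form_commute[of q m w] graph_form_scale_left)

lemma graph_energy_add:
  "graph_energy q m (\<lambda>x. u x + v x) = graph_energy q m u + 2 * graph_form q m u v + graph_energy q m v"
  using graph_form_commute[of q m u v]
  by (simp add: graph_form_add_left graph_form_add_right flip: graph_form_self)

lemma graph_energy_scale: "graph_energy q m (\<lambda>x. c * u x) = c\<^sup>2 * graph_energy q m u"
  by (simp add: graph_form_scale_left graph_form_scale_right power2_eq_square flip: graph_form_self)

lemma graph_energy_diff:
  "graph_energy q m (\<lambda>x. u x - v x) = graph_energy q m u - 2 * graph_form q m u v + graph_energy q m v"
  using graph_energy_add[of q m u "\<lambda>x. - 1 * v x"]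
  unfolding graph_energy_scale graph_form_scale_right by simp

lemma energy_bounded_scale: "energy_bounded q u \<Longrightarrow> energy_bounded q (\<lambda>x. c * u x)"
  unfolding energy_bounded_def graph_energy_scale by (meson mult_left_mono zero_le_power2)

text \<open>The parallelogram law bounds the energy of a sum by twice the sum of the
  energies.\<close>

lemma energy_bounded_add:
  assumes "energy_bounded q u" "energy_bounded q v"
  shows "energy_bounded q (\<lambda>x. u x + v x)"
proof -
  obtain M N where MN: "\<And>m. graph_energy q m u \<le> M" "\<And>m. graph_energy q m v \<le> N"
    using assms unfolding energy_bounded_def by blast
  have "graph_energy q m (\<lambda>x. u x + v x) \<le> 2 * M + 2 * N" for m
    using graph_energy_add[of q m u v] graph_energy_diff[of q m u v]
      graph_energy_nonneg[of q m "\<lambda>x. u x - v x"] MN[of m] by linarith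
  then show ?thesis unfolding energy_bounded_def by blast
qed

lemma energy_bounded_diff:
  "energy_bounded q u \<Longrightarrow> energy_bounded q v \<Longrightarrow> energy_bounded q (\<lambda>x. u x - v x)"
  using energy_bounded_add[of q u "\<lambda>x. - 1 * v x"] energy_bounded_scale[of q v "- 1"] by simp

lemma energy_bounded_cong:
  "(\<And>m x. x \<in> sg_V q m \<Longrightarrow> u x = v x) \<Longrightarrow> energy_bounded q u = energy_bounded q v"
  unfolding energy_bounded_def using graph_energy_cong[of q _ u v] by metis

text \<open>Clamping is 1-Lipschitz, so each edge difference can only shrink.\<close>

lemma graph_energy_clamp_le:
  "graph_energy q m (\<lambda>x. max a (min b (u x))) \<le> graph_energy q m u"
proof -
  have "(max a (min b s) - max a (min b t))\<^sup>2 \<le> (s - t)\<^sup>2" for s t :: real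
    by (subst abs_le_square_iff[symmetric]) linarith
  then show ?thesis
    unfolding graph_energy_def by (auto intro!: mult_left_mono sum_mono)
qed

context gasket begin

lemma graph_energy_0:
  "graph_energy q 0 u = (u (q 0) - u (q 1))\<^sup>2 + (u (q 1) - u (q 2))\<^sup>2 + (u (q 2) - u (q 0))\<^sup>2"
proof -
  have ne: "q 0 \<noteq> q 1" "q 1 \<noteq> q 2" "q 2 \<noteq> q 0" "q 1 \<noteq> q 0" "q 2 \<noteq> q 1" "q 0 \<noteq> q 2"
    by (simp_all add: vertices_eq_iff)
  have "{(x, y). sg_adj q 0 x y}
      = {(q 0, q 1), (q 1, q 0), (q 1, q 2), (q 2, q 1), (q 2, q 0), (q 0, q 2)}"
    using ne by (auto simp: sg_adj_def lessThan_3)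
  then show ?thesis
    unfolding graph_energy_def using ne by (simp add: power2_commute)
qed

text \<open>Distinct cells may share a point but never an edge, so the edge sum splits over the
  three cells.\<close>

lemma graph_energy_Suc: "graph_energy q (Suc m) u = 5/3 * (\<Sum>i<3. graph_energy q m (u \<circ> F i))"
proof -
  let ?A = "{(x, y). sg_adj q m x y}"
  let ?G = "\<lambda>i. map_prod (F i) (F i)"
  have set_eq: "{(x, y). sg_adj q (Suc m) x y} = (\<Union>i\<in>{..<3}. ?G i ` ?A)"
    by (auto simp: sg_adj_Suc)
  \<comment> \<open>Both endpoints of a common edge would be the unique touching point of the two
    cells.\<close>
  have disj: "?G i ` ?A \<inter> ?G j ` ?A = {}" if "i < 3" "j < 3" "i \<noteq> j" for i j
  proof (rule ccontr)
    assume "?G i ` ?A \<inter> ?G j ` ?A \<noteq> {}"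
    then obtain x y x' y' where xy: "sg_adj q m x y" "sg_adj q m x' y'" "F i x = F j x'" "F i y = F j y'"
      by (auto simp: map_prod_def)
    then have "x \<in> K" "y \<in> K" "x' \<in> K" "y' \<in> K" "x \<noteq> y"
      using sg_adj_in_V[of q m] sg_V_subset_SG[of q m] by (blast, blast, blast, blast, simp add: sg_adj_def)
    then show False
      using cells_touch[OF that _ _ xy(3)] cells_touch[OF that _ _ xy(4)] by simp
  qed
  have inj: "inj_on (?G i) ?A" for i
    by (auto simp: inj_on_def)
  have "(\<Sum>(x, y) \<in> {(x, y). sg_adj q (Suc m) x y}. (u x - u y)\<^sup>2)
      = (\<Sum>i<3. \<Sum>(x, y) \<in> ?G i ` ?A. (u x - u y)\<^sup>2)"
    unfolding set_eq using disj by (intro sum.UNION_disjoint) (auto simp: finite_sg_adj)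
  also have "\<dots> = (\<Sum>i<3. \<Sum>(x, y) \<in> ?A. ((u \<circ> F i) x - (u \<circ> F i) y)\<^sup>2)"
    by (intro sum.cong refl sum.reindex_cong[OF inj refl]) auto
  finally show ?thesis
    unfolding graph_energy_def by (simp add: sum_distrib_left algebra_simps)
qed

text \<open>The difference of the two energies is \<open>5/3\<close> times a sum of squares in the deviations of the
  midpoint values from the harmonic ones.\<close>

lemma graph_energy_0_le_1: "graph_energy q 0 u \<le> graph_energy q (Suc 0) u"
proof -
  \<comment> \<open>Here \<open>a\<close>, \<open>b\<close>, \<open>c\<close> are the corner values
    and \<open>x\<close>, \<open>y\<close>, \<open>z\<close> the values at the midpoints of the
    opposite sides. The harmonic value at the first midpoint is
    \<open>(a + 2*b + 2*c)/5\<close>.\<close>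
  have id: "5/3 * (((a - z)\<^sup>2 + (z - y)\<^sup>2 + (y - a)\<^sup>2) + ((z - b)\<^sup>2 + (b - x)\<^sup>2 + (x - z)\<^sup>2)
        + ((y - x)\<^sup>2 + (x - c)\<^sup>2 + (c - y)\<^sup>2))
      = (a - b)\<^sup>2 + (b - c)\<^sup>2 + (c - a)\<^sup>2 +
        5/3 * (2 * ((x - (a + 2*b + 2*c)/5)\<^sup>2 + (y - (b + 2*a + 2*c)/5)\<^sup>2 + (z - (c + 2*a + 2*b)/5)\<^sup>2)
        + ((x - (a + 2*b + 2*c)/5) - (y - (b + 2*a + 2*c)/5))\<^sup>2
        + ((y - (b + 2*a + 2*c)/5) - (z - (c + 2*a + 2*b)/5))\<^sup>2
        + ((z - (c + 2*a + 2*b)/5) - (x - (a + 2*b + 2*c)/5))\<^sup>2)" for a b c x y z :: real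
    by (simp add: power2_eq_square field_simps)
  have ineq: "(a - b)\<^sup>2 + (b - c)\<^sup>2 + (c - a)\<^sup>2 \<le>
      5/3 * (((a - z)\<^sup>2 + (z - y)\<^sup>2 + (y - a)\<^sup>2) + ((z - b)\<^sup>2 + (b - x)\<^sup>2 + (x - z)\<^sup>2)
        + ((y - x)\<^sup>2 + (x - c)\<^sup>2 + (c - y)\<^sup>2))" for a b c x y z :: real
    unfolding id by simp
  have e: "(\<Sum>i<3. f i) = f 0 + f 1 + f 2" for f :: "nat \<Rightarrow> real"
    by (simp add: lessThan_3 add_ac)
  show ?thesis
    unfolding graph_energy_Suc e graph_energy_0 comp_apply sg_map_fixpoint
      sg_map_vertex_commute[of 0] sg_map_vertex_commute[of 1 2]
    by (rule ineq)
qed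

section \<open>The energy form\<close>

lemma graph_energy_mono_Suc: "graph_energy q m u \<le> graph_energy q (Suc m) u"
proof (induction m arbitrary: u)
  case 0
  show ?case by (rule graph_energy_0_le_1)
next
  case (Suc m)
  have "(\<Sum>i<3. graph_energy q m (u \<circ> F i)) \<le> (\<Sum>i<3. graph_energy q (Suc m) (u \<circ> F i))"
    by (intro sum_mono Suc)
  then show ?case
    unfolding graph_energy_Suc[of "Suc m"] by (subst graph_energy_Suc) simp
qed

lemma incseq_graph_energy: "incseq (\<lambda>m. graph_energy q m u)"
  by (rule incseq_SucI) (rule graph_energy_mono_Suc)

lemma graph_energy_tendsto:
  assumes "energy_bounded q u" shows "(\<lambda>m. graph_energy q m u) \<longlonglongrightarrow> real_energy q u"
proof -
  obtain M where "\<And>m. graph_energy q m u \<le> M" using assms unfolding energy_bounded_def by blast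
  then obtain L where "(\<lambda>m. graph_energy q m u) \<longlonglongrightarrow> L"
    using incseq_convergent[OF incseq_graph_energy] by metis
  then show ?thesis unfolding real_energy_def by (simp add: limI)
qed

lemma graph_energy_le_real_energy: "energy_bounded q u \<Longrightarrow> graph_energy q m u \<le> real_energy q u"
  by (rule incseq_le[OF incseq_graph_energy graph_energy_tendsto])

lemma real_energy_nonneg: "energy_bounded q u \<Longrightarrow> real_energy q u \<ge> 0"
  using graph_energy_le_real_energy[of u 0] graph_energy_nonneg[of q 0 u] by linarith

lemma energy_eq:
  assumes "energy_bounded q u" shows "energy q u = ennreal (real_energy q u)"
  unfolding energy_def
  by (intro limI tendsto_ennrealI graph_energy_tendsto assms)

text \<open>Monotonicity makes the \<open>lim\<close> in \<open>energy\<close> a genuine limit,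
  namely the supremum, and a finite supremum bounds every level.\<close>

lemma energy_finite_iff: "energy q u < \<infinity> \<longleftrightarrow> energy_bounded q u"
proof
  assume fin: "energy q u < \<infinity>"
  have inc: "incseq (\<lambda>m. ennreal (graph_energy q m u))"
    using incseq_graph_energy[of u] by (auto simp: incseq_def intro: ennreal_leI)
  then have "energy q u = (SUP m. ennreal (graph_energy q m u))"
    unfolding energy_def by (intro limI LIMSEQ_SUP)
  then have le: "ennreal (graph_energy q m u) \<le> energy q u" for m
    by (metis SUP_upper UNIV_I)
  have "graph_energy q m u \<le> enn2real (energy q u)" for m
    using enn2real_mono[OF le[of m]] fin graph_energy_nonneg[of q m u] by simp
  then show "energy_bounded q u" unfolding energy_bounded_def by blast
qed (simp add: energy_eq)

lemma dom_energy_iff: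
  "u \<in> dom_energy q \<longleftrightarrow> u \<in> extensional K \<and> continuous_on K u \<and> energy_bounded q u"
  unfolding dom_energy_def energy_finite_iff by simp

text \<open>Polarization holds exactly at each level, so the polarized energies converge along with
  the graph forms.\<close>

lemma graph_form_tendsto:
  assumes "energy_bounded q u" "energy_bounded q v"
  shows "(\<lambda>m. graph_form q m u v) \<longlonglongrightarrow> energy_form q u v"
proof -
  have add: "energy_bounded q (\<lambda>x. u x + v x)" and diff: "energy_bounded q (\<lambda>x. u x - v x)"
    using assms by (rule energy_bounded_add, rule energy_bounded_diff)
  have "(\<lambda>m. (graph_energy q m (\<lambda>x. u x + v x) - graph_energy q m (\<lambda>x. u x - v x)) / 4)
      \<longlonglongrightarrow> (real_energy q (\<lambda>x. u x + v x) - real_energy q (\<lambda>x. u x - v x)) / 4"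
    by (intro tendsto_intros graph_energy_tendsto add diff) simp
  then show ?thesis
    unfolding energy_form_def energy_eq[OF add] energy_eq[OF diff]
    by (simp add: graph_energy_add graph_energy_diff real_energy_nonneg add diff)
qed

lemma energy_form_self: "energy_bounded q u \<Longrightarrow> energy_form q u u = real_energy q u"
  using graph_form_tendsto[of u u] graph_energy_tendsto[of u]
  unfolding graph_form_self by (blast intro: LIMSEQ_unique)

lemma energy_form_commute: "energy_form q u v = energy_form q v u"
proof -
  have "graph_energy q m (\<lambda>x. u x - v x) = graph_energy q m (\<lambda>x. v x - u x)" for m
    by (simp add: graph_energy_diff graph_form_commute[of q m u v])
  then show ?thesis unfolding energy_form_def energy_def by (simp add: add.commute)
qed

text \<open>Only values at vertices enter the energies. Hence functions can be handled without
  regard to their values off the gasket and restricted at the end.\<close>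

lemma energy_form_cong:
  assumes "\<And>x. x \<in> K \<Longrightarrow> u x = u' x" "\<And>x. x \<in> K \<Longrightarrow> v x = v' x"
  shows "energy_form q u v = energy_form q u' v'"
proof -
  have *: "x \<in> sg_V q m \<Longrightarrow> x \<in> K" for x m using sg_V_subset_SG by blast
  have "graph_energy q m (\<lambda>x. u x + v x) = graph_energy q m (\<lambda>x. u' x + v' x)"
    "graph_energy q m (\<lambda>x. u x - v x) = graph_energy q m (\<lambda>x. u' x - v' x)" for m
    by (rule graph_energy_cong, simp add: assms *)+
  then show ?thesis unfolding energy_form_def energy_def by simp
qed

lemma energy_bounded_SG_cong:
  "(\<And>x. x \<in> K \<Longrightarrow> u x = v x) \<Longrightarrow> energy_bounded q u = energy_bounded q v"
  by (rule energy_bounded_cong) (use sg_V_subset_SG in blast)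

lemma energy_form_add_left:
  assumes "energy_bounded q u" "energy_bounded q v" "energy_bounded q w"
  shows "energy_form q (\<lambda>x. u x + v x) w = energy_form q u w + energy_form q v w"
proof (rule LIMSEQ_unique)
  show "(\<lambda>m. graph_form q m (\<lambda>x. u x + v x) w) \<longlonglongrightarrow> energy_form q (\<lambda>x. u x + v x) w"
    by (intro graph_form_tendsto energy_bounded_add assms)
  show "(\<lambda>m. graph_form q m (\<lambda>x. u x + v x) w) \<longlonglongrightarrow> energy_form q u w + energy_form q v w"
    unfolding graph_form_add_left by (intro tendsto_add graph_form_tendsto assms)
qed

lemma energy_form_scale_left:
  assumes "energy_bounded q u" "energy_bounded q w"
  shows "energy_form q (\<lambda>x. c * u x) w = c * energy_form q u w"
proof (rule LIMSEQ_unique)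
  show "(\<lambda>m. graph_form q m (\<lambda>x. c * u x) w) \<longlonglongrightarrow> energy_form q (\<lambda>x. c * u x) w"
    by (intro graph_form_tendsto energy_bounded_scale assms)
  show "(\<lambda>m. graph_form q m (\<lambda>x. c * u x) w) \<longlonglongrightarrow> c * energy_form q u w"
    unfolding graph_form_scale_left by (intro tendsto_mult_left graph_form_tendsto assms)
qed

lemma energy_form_diff_left:
  assumes "energy_bounded q u" "energy_bounded q v" "energy_bounded q w"
  shows "energy_form q (\<lambda>x. u x - v x) w = energy_form q u w - energy_form q v w"
  using energy_form_add_left[of u "\<lambda>x. - 1 * v x" w] energy_form_scale_left[of v w "- 1"]
    energy_bounded_scale[of q v "- 1"] assms by simp

lemma energy_bounded_zero: "energy_bounded q (\<lambda>x. 0)"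
  unfolding energy_bounded_def graph_energy_def by auto

lemma energy_bounded_sum:
  "finite I \<Longrightarrow> (\<And>i. i \<in> I \<Longrightarrow> energy_bounded q (u i)) \<Longrightarrow> energy_bounded q (\<lambda>x. \<Sum>i\<in>I. c i * u i x)"
proof (induction I rule: finite_induct)
  case (insert j I)
  then show ?case
    using energy_bounded_add[OF energy_bounded_scale[of q "u j" "c j"], of "\<lambda>x. \<Sum>i\<in>I. c i * u i x"]
    by simp
qed (simp add: energy_bounded_zero)

lemma energy_form_zero_left: "energy_bounded q w \<Longrightarrow> energy_form q (\<lambda>x. 0) w = 0"
  using energy_form_scale_left[OF energy_bounded_zero, of w 0] by simp

lemma energy_form_sum_left:
  assumes w: "energy_bounded q w"
  shows "finite I \<Longrightarrow> (\<And>i. i \<in> I \<Longrightarrow> energy_bounded q (u i)) \<Longrightarrow>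
    energy_form q (\<lambda>x. \<Sum>i\<in>I. c i * u i x) w = (\<Sum>i\<in>I. c i * energy_form q (u i) w)"
proof (induction I rule: finite_induct)
  case (insert j I)
  then have "energy_form q (\<lambda>x. c j * u j x + (\<Sum>i\<in>I. c i * u i x)) w
      = energy_form q (\<lambda>x. c j * u j x) w + energy_form q (\<lambda>x. \<Sum>i\<in>I. c i * u i x) w"
    by (intro energy_form_add_left energy_bounded_scale energy_bounded_sum w) auto
  then show ?case using insert by (simp add: energy_form_scale_left w)
qed (simp add: energy_form_zero_left w)

lemma energy_form_Cauchy_Schwarz:
  assumes u: "energy_bounded q u" and v: "energy_bounded q v"
  shows "(energy_form q u v)\<^sup>2 \<le> real_energy q u * real_energy q v"
proof (rule LIMSEQ_le)
  show "(\<lambda>m. (graph_form q m u v)\<^sup>2) \<longlonglongrightarrow> (energy_form q u v)\<^sup>2"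
    by (intro tendsto_power graph_form_tendsto u v)
  show "(\<lambda>m. graph_energy q m u * graph_energy q m v) \<longlonglongrightarrow> real_energy q u * real_energy q v"
    by (intro tendsto_mult graph_energy_tendsto u v)
  have "(graph_form q m u v)\<^sup>2 \<le> graph_energy q m u * graph_energy q m v" for m
  proof -
    define k :: real where "k = (5/3)^m * (1/2)"
    let ?A = "{(x, y). sg_adj q m x y}"
    have "(k * (\<Sum>p\<in>?A. (u (fst p) - u (snd p)) * (v (fst p) - v (snd p))))\<^sup>2
        \<le> k\<^sup>2 * ((\<Sum>p\<in>?A. (u (fst p) - u (snd p))\<^sup>2) * (\<Sum>p\<in>?A. (v (fst p) - v (snd p))\<^sup>2))"
      unfolding power_mult_distrib by (intro mult_left_mono Cauchy_Schwarz_ineq_sum) auto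
    then show ?thesis
      unfolding graph_form_def graph_energy_def k_def
      by (simp add: case_prod_unfold power2_eq_square mult_ac)
  qed
  then show "\<exists>N. \<forall>m\<ge>N. (graph_form q m u v)\<^sup>2 \<le> graph_energy q m u * graph_energy q m v"
    by blast
qed

lemma vertex_difference_le:
  assumes "i < 3" "j < 3" shows "(u (q i) - u (q j))\<^sup>2 \<le> graph_energy q 0 u"
proof -
  have "i \<in> {0, 1, 2}" "j \<in> {0, 1, 2}" using assms by auto
  moreover have "(u (q 1) - u (q 0))\<^sup>2 = (u (q 0) - u (q 1))\<^sup>2"
    "(u (q 2) - u (q 1))\<^sup>2 = (u (q 1) - u (q 2))\<^sup>2" "(u (q 0) - u (q 2))\<^sup>2 = (u (q 2) - u (q 0))\<^sup>2"
    by (rule power2_commute)+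
  ultimately show ?thesis unfolding graph_energy_0 by auto
qed

text \<open>Passing to a cell multiplies the energy by at most \<open>3/5\<close>, so the oscillation by at most
  \<open>sqrt (3/5) \<le> 4/5\<close>; the constant \<open>5\<close> solves \<open>C = 1 + 4/5 * C\<close>.\<close>

lemma vertex_oscillation:
  "x \<in> V m \<Longrightarrow> (\<And>k. k \<le> m \<Longrightarrow> graph_energy q k u \<le> d\<^sup>2) \<Longrightarrow> d \<ge> 0 \<Longrightarrow> l < 3 \<Longrightarrow> \<bar>u x - u (q l)\<bar> \<le> 5 * d"
proof (induction m arbitrary: x u d l)
  case 0
  have *: "\<bar>u (q i) - u (q j)\<bar> \<le> d" if "i < 3" "j < 3" for i j
  proof (rule abs_le_square_iff[THEN iffD2, of _ d, unfolded abs_of_nonneg[OF \<open>0 \<le> d\<close>]])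
    have "(u (q i) - u (q j))\<^sup>2 \<le> graph_energy q 0 u"
      by (rule vertex_difference_le[OF that])
    also have "\<dots> \<le> d\<^sup>2" by (rule 0(2)) simp
    finally show "(u (q i) - u (q j))\<^sup>2 \<le> d\<^sup>2" .
  qed
  obtain i where "i < 3" "x = q i" using 0(1) by auto
  then show ?case using *[of i l] 0 by simp
next
  case (Suc m)
  obtain i y where iy: "i < 3" "y \<in> V m" "x = F i y" using Suc.prems(1) by auto
  have e: "graph_energy q k (u \<circ> F i) \<le> (4/5 * d)\<^sup>2" if "k \<le> m" for k
  proof -
    have "graph_energy q k (u \<circ> F i) \<le> (\<Sum>i<3. graph_energy q k (u \<circ> F i))"
      by (rule member_le_sum) (use iy graph_energy_nonneg in auto)
    also have "\<dots> = 3/5 * graph_energy q (Suc k) u" unfolding graph_energy_Suc by simp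
    also have "\<dots> \<le> 3/5 * d\<^sup>2" using Suc.prems(2)[of "Suc k"] that by simp
    also have "\<dots> \<le> (4/5 * d)\<^sup>2" by (simp add: power2_eq_square)
    finally show ?thesis .
  qed
  \<comment> \<open>The reference vertex \<open>q i\<close> is fixed by \<open>F i\<close>, so the
    estimate inside the cell compares with a vertex of the large triangle; passing from there to
    \<open>q l\<close> costs one more \<open>d\<close>.\<close>
  have "\<bar>(u \<circ> F i) y - (u \<circ> F i) (q i)\<bar> \<le> 5 * (4/5 * d)"
    using Suc.prems(3) by (intro Suc.IH[OF iy(2) e _ iy(1)]) auto
  then have 1: "\<bar>u x - u (q i)\<bar> \<le> 4 * d" using iy(3) by simp
  have "(u (q i) - u (q l))\<^sup>2 \<le> graph_energy q 0 u"
    by (rule vertex_difference_le[OF iy(1) Suc.prems(4)])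
  also have "\<dots> \<le> d\<^sup>2" by (rule Suc.prems(2)) simp
  finally have "\<bar>u (q i) - u (q l)\<bar> \<le> d"
    using Suc.prems(3) by (metis abs_le_square_iff abs_of_nonneg)
  with 1 show ?case by linarith
qed

text \<open>The bound holds at the vertices with a constant that does not depend on the level, and
  continuity carries it to their closure.\<close>

lemma oscillation:
  assumes u: "continuous_on K u" "energy_bounded q u" and x: "x \<in> K" and l: "l < 3"
  shows "\<bar>u x - u (q l)\<bar> \<le> 5 * sqrt (real_energy q u)"
proof -
  have "norm (u x - u (q l)) \<le> 5 * sqrt (real_energy q u)"
  proof (rule continuous_on_closure_norm_le[where f = "\<lambda>y. u y - u (q l)"])
    show "continuous_on (closure (\<Union>m. V m)) (\<lambda>x. u x - u (q l))"
      unfolding SG_eq_closure[symmetric] by (intro continuous_intros u)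
    show "x \<in> closure (\<Union>m. V m)" using x unfolding SG_eq_closure .
    show "\<forall>y\<in>\<Union>m. V m. norm (u y - u (q l)) \<le> 5 * sqrt (real_energy q u)"
      using vertex_oscillation[OF _ _ _ l, of _ _ u "sqrt (real_energy q u)"]
        graph_energy_le_real_energy[OF u(2)] real_energy_nonneg[OF u(2)]
      by auto
  qed
  then show ?thesis by simp
qed

section \<open>Functions of finite energy with prescribed vertex values\<close>

text \<open>The formula \<open>2 *\<^sub>R x - q i\<close> inverts \<open>F i\<close>. At a junction
  \<open>LEAST\<close> decides which cell is read; under \<open>gluable\<close> both give the same
  value.\<close>

definition glue :: "(nat \<Rightarrow> real^2 \<Rightarrow> real) \<Rightarrow> real^2 \<Rightarrow> real" where
  "glue v x = (let i = (LEAST i. i < 3 \<and> x \<in> F i ` K) in v i (2 *\<^sub>R x - q i))"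

definition gluable :: "(nat \<Rightarrow> real^2 \<Rightarrow> real) \<Rightarrow> bool" where
  "gluable v \<longleftrightarrow> (\<forall>i<3. \<forall>j<3. v i (q j) = v j (q i))"

lemma sg_map_inverse [simp]: "2 *\<^sub>R F i x - q i = x"
  by (simp add: sg_map_def)

lemma glue_sg_map:
  assumes v: "gluable v" and i: "i < 3" and x: "x \<in> K"
  shows "glue v (F i x) = v i x"
proof -
  define l where "l = (LEAST l. l < 3 \<and> F i x \<in> F l ` K)"
  have "l < 3 \<and> F i x \<in> F l ` K"
    unfolding l_def by (rule LeastI[of _ i]) (use i x in auto)
  then obtain y where y: "l < 3" "y \<in> K" "F i x = F l y" by blast
  have "glue v (F i x) = v l (2 *\<^sub>R F i x - q l)"
    unfolding glue_def l_def Let_def ..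
  then have g: "glue v (F i x) = v l y"
    unfolding y(3) sg_map_inverse .
  show ?thesis
  proof (cases "l = i")
    case False
    then have "x = q l" "y = q i" using cells_touch[OF i y(1) _ x y(2,3)] by auto
    then show ?thesis using g v i y(1) unfolding gluable_def by simp
  qed (use g y(3) in simp)
qed

lemma continuous_on_glue:
  assumes v: "gluable v" and c: "\<And>i. i < 3 \<Longrightarrow> continuous_on K (v i)"
  shows "continuous_on K (glue v)"
proof -
  have "continuous_on (F i ` K) (glue v)" if i: "i < 3" for i
  proof -
    have "continuous_on (F i ` K) (\<lambda>z. v i (2 *\<^sub>R z - q i))"
      by (rule continuous_on_compose2[OF c[OF i]]) (auto intro!: continuous_intros)
    then show ?thesis
      by (rule continuous_on_cong[THEN iffD1, rotated 2]) (auto simp: glue_sg_map[OF v i])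
  qed
  moreover have "closed (F i ` K)" for i
    by (intro compact_imp_closed compact_continuous_image continuous_on_sg_map compact_SG)
  ultimately have "continuous_on (\<Union>i\<in>{..<3}. F i ` K) (glue v)"
    by (intro continuous_on_closed_Union) auto
  then show ?thesis by (simp only: SG_fixed[symmetric])
qed

lemma graph_energy_sg_map_cong:
  assumes "\<And>i x. i < 3 \<Longrightarrow> x \<in> K \<Longrightarrow> u (F i x) = v i x"
  shows "graph_energy q (Suc k) u = 5/3 * (\<Sum>i<3. graph_energy q k (v i))"
proof -
  have "graph_energy q k (u \<circ> F i) = graph_energy q k (v i)" if "i < 3" for i
    by (rule graph_energy_cong) (use assms[OF that] sg_V_subset_SG[of q k] in auto)
  then show ?thesis unfolding graph_energy_Suc by simp
qed

lemma energy_bounded_glue: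
  assumes v: "gluable v" and b: "\<And>i. i < 3 \<Longrightarrow> energy_bounded q (v i)"
  shows "energy_bounded q (glue v)"
proof -
  have "graph_energy q k (glue v) \<le> 5/3 * (\<Sum>i<3. real_energy q (v i))" for k
  proof -
    have "graph_energy q k (glue v) \<le> graph_energy q (Suc k) (glue v)"
      by (rule graph_energy_mono_Suc)
    also have "\<dots> = 5/3 * (\<Sum>i<3. graph_energy q k (v i))"
      by (rule graph_energy_sg_map_cong) (rule glue_sg_map[OF v])
    also have "\<dots> \<le> 5/3 * (\<Sum>i<3. real_energy q (v i))"
      by (intro mult_left_mono sum_mono graph_energy_le_real_energy b) auto
    finally show ?thesis .
  qed
  then show ?thesis unfolding energy_bounded_def by blast
qed

text \<open>\<open>harmonic_values a i\<close> are the values at the corners of the \<open>i\<close>-th cell of the harmonic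
  function with boundary values \<open>a\<close>.\<close>

definition harmonic_values :: "(nat \<Rightarrow> real) \<Rightarrow> nat \<Rightarrow> nat \<Rightarrow> real" where
  "harmonic_values a i j = (if i = j then a i else (a 0 + a 1 + a 2 + a i + a j) / 5)"

text \<open>A cone of height 1 at \<open>q j\<close> whose radius is the side length, so it vanishes
  at the other two vertices. It seeds the iteration below.\<close>

definition bump :: "nat \<Rightarrow> real^2 \<Rightarrow> real" where
  "bump j x = max 0 (1 - dist x (q j) / side)"

text \<open>The \<open>k\<close>-th iterate has the harmonic values on \<open>V k\<close> and a
  crude continuous interpolation inside the cells of level \<open>k\<close>. Every iterate is
  continuous, so a uniform limit is too.\<close>

primrec harmonic_approx :: "nat \<Rightarrow> (nat \<Rightarrow> real) \<Rightarrow> real^2 \<Rightarrow> real" where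
  "harmonic_approx 0 a = (\<lambda>x. a 0 + (a 1 - a 0) * bump 1 x + (a 2 - a 0) * bump 2 x)"
| "harmonic_approx (Suc k) a = glue (\<lambda>i. harmonic_approx k (harmonic_values a i))"

lemma bump_vertex: "i < 3 \<Longrightarrow> j < 3 \<Longrightarrow> bump j (q i) = (if i = j then 1 else 0)"
  using dist_vertices[of i j] side_pos by (simp add: bump_def)

lemma bump_bounds: "0 \<le> bump j x" "bump j x \<le> 1"
  using side_pos by (simp_all add: bump_def)

lemma harmonic_values_commute: "harmonic_values a i j = harmonic_values a j i"
  by (simp add: harmonic_values_def)

lemma harmonic_approx_vertex: "l < 3 \<Longrightarrow> harmonic_approx k a (q l) = a l"
proof (induction k arbitrary: a l)
  case 0
  then have "l \<in> {0, 1, 2}" by auto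
  then show ?case by (auto simp: bump_vertex)
next
  case (Suc k)
  then have "gluable (\<lambda>i. harmonic_approx k (harmonic_values a i))"
    unfolding gluable_def by (simp add: harmonic_values_commute)
  from glue_sg_map[OF this Suc.prems vertex_in_SG[OF Suc.prems]] show ?case
    using Suc by (simp add: harmonic_values_def)
qed

lemma gluable_harmonic_approx: "gluable (\<lambda>i. harmonic_approx k (harmonic_values a i))"
  unfolding gluable_def by (simp add: harmonic_values_commute harmonic_approx_vertex)

lemma harmonic_approx_sg_map:
  "i < 3 \<Longrightarrow> x \<in> K \<Longrightarrow> harmonic_approx (Suc k) a (F i x) = harmonic_approx k (harmonic_values a i) x"
  using glue_sg_map[OF gluable_harmonic_approx] by simp

lemma continuous_on_harmonic_approx: "continuous_on K (harmonic_approx k a)"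
proof (induction k arbitrary: a)
  case 0
  show ?case using side_pos by (auto simp: bump_def intro!: continuous_intros)
next
  case (Suc k)
  then show ?case using continuous_on_glue[OF gluable_harmonic_approx] by simp
qed

definition osc_le :: "(nat \<Rightarrow> real) \<Rightarrow> real \<Rightarrow> bool" where
  "osc_le a d \<longleftrightarrow> \<bar>a 0 - a 1\<bar> \<le> d \<and> \<bar>a 1 - a 2\<bar> \<le> d \<and> \<bar>a 2 - a 0\<bar> \<le> d"

text \<open>The extreme case is a corner against a midpoint:
  \<open>a 0 - (2 * a 0 + 2 * a 1 + a 2) / 5\<close> equals
  \<open>(2 * (a 0 - a 1) + (a 0 - a 2)) / 5\<close>, whence the factor 3/5. Two midpoints differ by
  only a fifth of a corner difference.\<close>

lemma osc_le_harmonic_values: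
  assumes "osc_le a d" "i < 3" shows "osc_le (harmonic_values a i) (3/5 * d)"
proof -
  have d: "a 0 - a 1 \<le> d" "a 1 - a 0 \<le> d" "a 1 - a 2 \<le> d" "a 2 - a 1 \<le> d" "a 2 - a 0 \<le> d" "a 0 - a 2 \<le> d"
    using assms(1) unfolding osc_le_def by linarith+
  consider "i = 0" | "i = 1" | "i = 2" using assms(2) by linarith
  then show ?thesis
    by cases (use d in \<open>simp_all add: osc_le_def harmonic_values_def abs_le_iff field_simps\<close>)
qed

lemma harmonic_approx_0_near:
  assumes "osc_le a d" shows "\<bar>harmonic_approx 0 a x - a 0\<bar> \<le> 2 * d"
proof -
  have "\<bar>(a j - a 0) * bump j x\<bar> \<le> d" if "\<bar>a j - a 0\<bar> \<le> d" for j
    using mult_mono[OF that bump_bounds(2)[of j x]] that bump_bounds(1)[of j x]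
    by (simp add: abs_mult)
  from this[of 1] this[of 2] show ?thesis
    using assms unfolding osc_le_def harmonic_approx.simps by linarith
qed

text \<open>By self-similarity this is the case \<open>k = 0\<close> on a cell of level
  \<open>k\<close>, whose corner values oscillate by at most \<open>(3/5)^k * d\<close>. For
  \<open>k = 0\<close> the three contributions are 6/5, 3/5 and 2 times \<open>d\<close>; their sum
  19/5 is rounded up to 4.\<close>

lemma harmonic_approx_step:
  "osc_le a d \<Longrightarrow> x \<in> K \<Longrightarrow> \<bar>harmonic_approx (Suc k) a x - harmonic_approx k a x\<bar> \<le> 4 * d * (3/5)^k"
proof (induction k arbitrary: a d x)
  case 0
  obtain i y where iy: "i < 3" "y \<in> K" "x = F i y" using sg_map_in_SG_cases[OF 0(2)] .
  have "\<bar>harmonic_approx 0 (harmonic_values a i) y - harmonic_values a i 0\<bar> \<le> 2 * (3/5 * d)"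
    by (rule harmonic_approx_0_near[OF osc_le_harmonic_values[OF 0(1) iy(1)]])
  moreover have "\<bar>harmonic_values a i 0 - a 0\<bar> \<le> 3/5 * d"
  proof -
    have d: "a 0 - a 1 \<le> d" "a 1 - a 0 \<le> d" "a 2 - a 0 \<le> d" "a 0 - a 2 \<le> d"
      using 0(1) unfolding osc_le_def by linarith+
    consider "i = 0" | "i = 1" | "i = 2" using iy(1) by linarith
    then show ?thesis
      by cases (use d in \<open>simp_all add: harmonic_values_def abs_le_iff field_simps\<close>)
  qed
  moreover have "\<bar>harmonic_approx 0 a x - a 0\<bar> \<le> 2 * d" by (rule harmonic_approx_0_near[OF 0(1)])
  moreover have "0 \<le> d" using 0(1) unfolding osc_le_def by linarith
  ultimately show ?case
    unfolding iy(3) harmonic_approx_sg_map[OF iy(1,2)] power_0 mult_1_right by linarith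
next
  case (Suc k)
  obtain i y where iy: "i < 3" "y \<in> K" "x = F i y" using sg_map_in_SG_cases[OF Suc.prems(2)] .
  show ?case
    using Suc.IH[OF osc_le_harmonic_values[OF Suc.prems(1) iy(1)] iy(2)]
    unfolding iy(3) harmonic_approx_sg_map[OF iy(1,2)] by simp
qed

text \<open>The limit of the iterates, written as a telescoping series so that the Weierstrass test
  yields uniform convergence.\<close>

definition harmonic :: "(nat \<Rightarrow> real) \<Rightarrow> real^2 \<Rightarrow> real" where
  "harmonic a x = harmonic_approx 0 a x + (\<Sum>n. harmonic_approx (Suc n) a x - harmonic_approx n a x)"

lemma harmonic_uniform_limit: "uniform_limit K (\<lambda>k. harmonic_approx k a) (harmonic a) sequentially"
proof -
  define d where "d = 2 * (\<bar>a 0\<bar> + \<bar>a 1\<bar> + \<bar>a 2\<bar>)"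
  have d: "osc_le a d" unfolding osc_le_def d_def by (auto simp: abs_le_iff)
  have "uniform_limit K (\<lambda>k x. \<Sum>n<k. harmonic_approx (Suc n) a x - harmonic_approx n a x)
      (\<lambda>x. \<Sum>n. harmonic_approx (Suc n) a x - harmonic_approx n a x) sequentially"
    by (rule Weierstrass_m_test[where M = "\<lambda>n. 4 * d * (3/5)^n"])
      (use harmonic_approx_step[OF d] in \<open>auto intro!: summable_mult summable_geometric\<close>)
  then have "uniform_limit K
      (\<lambda>k x. harmonic_approx 0 a x + (\<Sum>n<k. harmonic_approx (Suc n) a x - harmonic_approx n a x))
      (\<lambda>x. harmonic_approx 0 a x + (\<Sum>n. harmonic_approx (Suc n) a x - harmonic_approx n a x)) sequentially"
    by (intro uniform_limit_intros)
  moreover have "(\<Sum>n<k. harmonic_approx (Suc n) a x - harmonic_approx n a x)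
      = harmonic_approx k a x - harmonic_approx 0 a x" for k x
    by (rule sum_lessThan_telescope)
  ultimately show ?thesis
    unfolding harmonic_def[abs_def] by (simp del: harmonic_approx.simps)
qed

lemma harmonic_tendsto: "x \<in> K \<Longrightarrow> (\<lambda>k. harmonic_approx k a x) \<longlonglongrightarrow> harmonic a x"
  by (rule tendsto_uniform_limitI[OF harmonic_uniform_limit])

lemma continuous_on_harmonic: "continuous_on K (harmonic a)"
  by (rule uniform_limit_theorem[OF _ harmonic_uniform_limit])
    (auto simp: continuous_on_harmonic_approx)

lemma harmonic_vertex: "l < 3 \<Longrightarrow> harmonic a (q l) = a l"
  using harmonic_tendsto[OF vertex_in_SG, of l a] by (simp add: harmonic_approx_vertex LIMSEQ_const_iff)

lemma harmonic_sg_map: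
  assumes "i < 3" "x \<in> K" shows "harmonic a (F i x) = harmonic (harmonic_values a i) x"
proof (rule LIMSEQ_unique)
  show "(\<lambda>k. harmonic_approx (Suc k) a (F i x)) \<longlonglongrightarrow> harmonic a (F i x)"
    by (rule LIMSEQ_Suc[OF harmonic_tendsto]) (rule sg_map_in_SG[OF assms])
  show "(\<lambda>k. harmonic_approx (Suc k) a (F i x)) \<longlonglongrightarrow> harmonic (harmonic_values a i) x"
    unfolding harmonic_approx_sg_map[OF assms] by (rule harmonic_tendsto[OF assms(2)])
qed

text \<open>With oscillation zero every increment of the series vanishes. This makes extensions
  constant on cells with constant corner values.\<close>

lemma harmonic_const:
  assumes "\<And>i. i < 3 \<Longrightarrow> a i = c" "x \<in> K" shows "harmonic a x = c"
proof -
  have a: "a 0 = c" "a 1 = c" "a 2 = c" using assms(1) by auto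
  then have "osc_le a 0" unfolding osc_le_def by simp
  from harmonic_approx_step[OF this assms(2)]
  have "harmonic_approx (Suc n) a x - harmonic_approx n a x = 0" for n
    by (simp del: harmonic_approx.simps)
  then show ?thesis
    unfolding harmonic_def harmonic_approx.simps(1) a by simp
qed

text \<open>For the harmonic midpoint values the deviations in the comparison of levels 0 and 1 are
  zero, so subdivision preserves the energy exactly.\<close>

lemma graph_energy_harmonic:
  "graph_energy q k (harmonic a) = (a 0 - a 1)\<^sup>2 + (a 1 - a 2)\<^sup>2 + (a 2 - a 0)\<^sup>2"
proof (induction k arbitrary: a)
  case 0
  show ?case by (simp add: graph_energy_0 harmonic_vertex)
next
  case (Suc k)
  have "graph_energy q (Suc k) (harmonic a)
      = 5/3 * (\<Sum>i<3. graph_energy q k (harmonic (harmonic_values a i)))"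
    by (rule graph_energy_sg_map_cong) (rule harmonic_sg_map)
  then show ?case
    unfolding Suc by (simp add: lessThan_3 harmonic_values_def power2_eq_square field_simps)
qed

lemma energy_bounded_harmonic: "energy_bounded q (harmonic a)"
  unfolding energy_bounded_def graph_energy_harmonic by blast

text \<open>The piecewise harmonic function of level \<open>n\<close>: extend on each of the three
  cells, then glue; the pieces match since both take the value of \<open>u\<close> at a junction.
  The clause on constant cells controls values between vertices, as needed for approximating
  indicators.\<close>

lemma extension:
  "\<exists>v. continuous_on K v \<and> energy_bounded q v \<and> (\<forall>x\<in>V n. v x = u x) \<and>
    (\<forall>w\<in>sg_words n. \<forall>c. (\<forall>p\<in>sg_word_map q w ` V 0. u p = c) \<longrightarrow> (\<forall>x\<in>sg_word_map q w ` K. v x = c))"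
proof (induction n arbitrary: u)
  case 0
  show ?case
    by (rule exI[of _ "harmonic (\<lambda>i. u (q i))"])
      (auto simp: continuous_on_harmonic energy_bounded_harmonic harmonic_vertex harmonic_const)
next
  case (Suc n)
  have "\<forall>i. \<exists>v. continuous_on K v \<and> energy_bounded q v \<and> (\<forall>x\<in>V n. v x = (u \<circ> F i) x) \<and>
    (\<forall>w\<in>sg_words n. \<forall>c. (\<forall>p\<in>sg_word_map q w ` V 0. (u \<circ> F i) p = c) \<longrightarrow>
      (\<forall>x\<in>sg_word_map q w ` K. v x = c))"
    using Suc by blast
  then obtain v where v: "\<And>i. continuous_on K (v i)" "\<And>i. energy_bounded q (v i)"
    "\<And>i x. x \<in> V n \<Longrightarrow> v i x = (u \<circ> F i) x"
    "\<And>i w c x. w \<in> sg_words n \<Longrightarrow> \<forall>p\<in>sg_word_map q w ` V 0. (u \<circ> F i) p = c \<Longrightarrow>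
        x \<in> sg_word_map q w ` K \<Longrightarrow> v i x = c"
    by metis
  have g: "gluable v"
    unfolding gluable_def by (simp add: v(3) vertex_in_sg_V sg_map_vertex_commute)
  show ?case
  proof (intro exI[of _ "glue v"] conjI ballI allI impI)
    show "continuous_on K (glue v)" by (rule continuous_on_glue[OF g v(1)])
    show "energy_bounded q (glue v)" by (rule energy_bounded_glue[OF g v(2)])
    show "glue v x = u x" if x: "x \<in> V (Suc n)" for x
    proof -
      obtain i y where iy: "i < 3" "y \<in> V n" "x = F i y" using x by auto
      then have "y \<in> K" using sg_V_subset_SG by blast
      then show ?thesis using iy v(3)[OF iy(2)] by (simp add: glue_sg_map[OF g])
    qed
    fix w c x
    assume w: "w \<in> sg_words (Suc n)" and c: "\<forall>p\<in>sg_word_map q w ` V 0. u p = c"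
      and x: "x \<in> sg_word_map q w ` K"
    obtain i w' where iw: "w = i # w'" "i < 3" "w' \<in> sg_words n"
      using w unfolding sg_words_Suc by blast
    obtain y where y: "y \<in> sg_word_map q w' ` K" "x = F i y"
      using x unfolding iw(1) by auto
    have "\<forall>p\<in>sg_word_map q w' ` V 0. (u \<circ> F i) p = c"
      using c unfolding iw(1) by (simp add: image_comp)
    then have "v i y = c" using v(4)[OF iw(3) _ y(1)] by blast
    moreover have "y \<in> K" using y(1) sg_word_map_SG_subset[OF iw(3)] by blast
    ultimately show "glue v x = c" using iw(2) y(2) by (simp add: glue_sg_map[OF g])
  qed
qed

text \<open>Clamping the extension to the unit interval keeps the energy bounded and leaves the
  values 0 and 1 untouched.\<close>

lemma extension_unit_interval:
  assumes u: "\<And>x. x \<in> V n \<Longrightarrow> u x = 0 \<or> u x = 1"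
  obtains v where "continuous_on K v" "energy_bounded q v" "\<And>x. x \<in> V n \<Longrightarrow> v x = u x"
    "\<And>x. 0 \<le> v x \<and> v x \<le> 1"
    "\<And>w c x. w \<in> sg_words n \<Longrightarrow> c = 0 \<or> c = 1 \<Longrightarrow> (\<And>p. p \<in> sg_word_map q w ` V 0 \<Longrightarrow> u p = c) \<Longrightarrow>
        x \<in> sg_word_map q w ` K \<Longrightarrow> v x = c"
proof -
  obtain v where v: "continuous_on K v" "energy_bounded q v" "\<forall>x\<in>V n. v x = u x"
    "\<forall>w\<in>sg_words n. \<forall>c. (\<forall>p\<in>sg_word_map q w ` V 0. u p = c) \<longrightarrow>
        (\<forall>x\<in>sg_word_map q w ` K. v x = c)"
    using extension[of n u] by (elim exE conjE) (rule that)
  show thesis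
  proof (rule that[of "\<lambda>x. max 0 (min 1 (v x))"])
    show "continuous_on K (\<lambda>x. max 0 (min 1 (v x)))" by (intro continuous_intros v)
    show "energy_bounded q (\<lambda>x. max 0 (min 1 (v x)))"
      using v(2) order_trans[OF graph_energy_clamp_le[of q _ 0 1 v]] unfolding energy_bounded_def by metis
    show "max 0 (min 1 (v x)) = u x" if "x \<in> V n" for x using bspec[OF v(3) that] u[OF that] by auto
    show "max 0 (min 1 (v x)) = c" if "w \<in> sg_words n" "c = 0 \<or> c = 1"
      "\<And>p. p \<in> sg_word_map q w ` V 0 \<Longrightarrow> u p = c" "x \<in> sg_word_map q w ` K" for w c x
    proof -
      have "v x = c" using v(4) that(1,3,4) by blast
      then show ?thesis using that(2) by auto
    qed
  qed auto
qed

section \<open>The energy Hilbert space\<close>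

text \<open>The \<open>extensional\<close> normalization of \<open>dom_energy\<close> is dropped
  because pointwise sums and multiples need not be \<open>undefined\<close> off the gasket;
  \<open>restrict\<close> leads back.\<close>

definition W :: "(real^2 \<Rightarrow> real) set" where
  "W = {u. continuous_on K u \<and> energy_bounded q u}"

definition W0 :: "(real^2 \<Rightarrow> real) set" where
  "W0 = {u \<in> W. \<forall>i<3. u (q i) = 0}"

lemma W_bounded: "u \<in> W \<Longrightarrow> energy_bounded q u"
  and W_continuous: "u \<in> W \<Longrightarrow> continuous_on K u"
  by (simp_all add: W_def)

lemma W0_W: "u \<in> W0 \<Longrightarrow> u \<in> W" and W0_bounded: "u \<in> W0 \<Longrightarrow> energy_bounded q u"
  by (simp_all add: W0_def W_bounded)

lemma W_add: "u \<in> W \<Longrightarrow> v \<in> W \<Longrightarrow> (\<lambda>x. u x + v x) \<in> W"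
  and W_diff: "u \<in> W \<Longrightarrow> v \<in> W \<Longrightarrow> (\<lambda>x. u x - v x) \<in> W"
  and W_scale: "u \<in> W \<Longrightarrow> (\<lambda>x. c * u x) \<in> W"
  by (auto simp: W_def intro!: continuous_intros energy_bounded_add energy_bounded_diff energy_bounded_scale)

lemma W_sum: "finite I \<Longrightarrow> (\<And>i. i \<in> I \<Longrightarrow> u i \<in> W) \<Longrightarrow> (\<lambda>x. \<Sum>i\<in>I. c i * u i x) \<in> W"
  by (auto simp: W_def intro!: continuous_intros energy_bounded_sum)

lemma W0_add: "u \<in> W0 \<Longrightarrow> v \<in> W0 \<Longrightarrow> (\<lambda>x. u x + v x) \<in> W0"
  and W0_diff: "u \<in> W0 \<Longrightarrow> v \<in> W0 \<Longrightarrow> (\<lambda>x. u x - v x) \<in> W0"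
  and W0_scale: "u \<in> W0 \<Longrightarrow> (\<lambda>x. c * u x) \<in> W0"
  by (simp_all add: W0_def W_add W_diff W_scale)

lemma W0_sum: "finite I \<Longrightarrow> (\<And>i. i \<in> I \<Longrightarrow> u i \<in> W0) \<Longrightarrow> (\<lambda>x. \<Sum>i\<in>I. c i * u i x) \<in> W0"
  by (simp add: W0_def W_sum)

lemma W_cong: "(\<And>x. x \<in> K \<Longrightarrow> u x = v x) \<Longrightarrow> u \<in> W \<longleftrightarrow> v \<in> W"
  unfolding W_def using energy_bounded_SG_cong[of u v] continuous_on_cong[of K K u v] by auto

lemma restrict_W_iff: "restrict u K \<in> W \<longleftrightarrow> u \<in> W"
  by (rule W_cong) simp

lemma zero_in_W0: "(\<lambda>x. 0) \<in> W0"
  by (simp add: W0_def W_def energy_bounded_zero)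

section \<open>Energy identities, completeness and the Riesz representation\<close>

lemma real_energy_add:
  assumes "energy_bounded q u" "energy_bounded q v"
  shows "real_energy q (\<lambda>x. u x + v x) = real_energy q u + 2 * energy_form q u v + real_energy q v"
proof (rule LIMSEQ_unique)
  show "(\<lambda>m. graph_energy q m (\<lambda>x. u x + v x)) \<longlonglongrightarrow> real_energy q (\<lambda>x. u x + v x)"
    by (intro graph_energy_tendsto energy_bounded_add assms)
  show "(\<lambda>m. graph_energy q m (\<lambda>x. u x + v x)) \<longlonglongrightarrow>
      real_energy q u + 2 * energy_form q u v + real_energy q v"
    unfolding graph_energy_add by (intro tendsto_intros graph_energy_tendsto graph_form_tendsto assms)
qed

lemma real_energy_scale:
  assumes "energy_bounded q u"
  shows "real_energy q (\<lambda>x. c * u x) = c\<^sup>2 * real_energy q u"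
proof (rule LIMSEQ_unique)
  show "(\<lambda>m. graph_energy q m (\<lambda>x. c * u x)) \<longlonglongrightarrow> real_energy q (\<lambda>x. c * u x)"
    by (intro graph_energy_tendsto energy_bounded_scale assms)
  show "(\<lambda>m. graph_energy q m (\<lambda>x. c * u x)) \<longlonglongrightarrow> c\<^sup>2 * real_energy q u"
    unfolding graph_energy_scale by (intro tendsto_intros graph_energy_tendsto assms)
qed

lemma real_energy_diff:
  assumes "energy_bounded q u" "energy_bounded q v"
  shows "real_energy q (\<lambda>x. u x - v x) = real_energy q u - 2 * energy_form q u v + real_energy q v"
proof (rule LIMSEQ_unique)
  show "(\<lambda>m. graph_energy q m (\<lambda>x. u x - v x)) \<longlonglongrightarrow> real_energy q (\<lambda>x. u x - v x)"
    by (intro graph_energy_tendsto energy_bounded_diff assms)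
  show "(\<lambda>m. graph_energy q m (\<lambda>x. u x - v x)) \<longlonglongrightarrow>
      real_energy q u - 2 * energy_form q u v + real_energy q v"
    unfolding graph_energy_diff by (intro tendsto_intros graph_energy_tendsto graph_form_tendsto assms)
qed

lemma W0_sup_bound: "v \<in> W0 \<Longrightarrow> x \<in> K \<Longrightarrow> \<bar>v x\<bar> \<le> 5 * sqrt (real_energy q v)"
  using oscillation[of v x 0] by (simp add: W0_def W_def)

lemma W0_eq_zero: "v \<in> W0 \<Longrightarrow> real_energy q v \<le> 0 \<Longrightarrow> x \<in> K \<Longrightarrow> v x = 0"
  using W0_sup_bound[of v x] real_energy_nonneg[of v] W0_bounded[of v] by simp

text \<open>The sup bound makes an energy-Cauchy sequence uniformly Cauchy, which supplies a
  continuous candidate. Convergence in energy then follows from a bound on all graph energies that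
  is uniform in the level.\<close>

lemma W0_complete:
  assumes s: "\<And>n. s n \<in> W0"
    and C: "\<And>e. e > 0 \<Longrightarrow> \<exists>N. \<forall>m\<ge>N. \<forall>n\<ge>N. real_energy q (\<lambda>x. s m x - s n x) < e"
  obtains u where "u \<in> W0" "(\<lambda>n. real_energy q (\<lambda>x. s n x - u x)) \<longlonglongrightarrow> 0"
proof -
  have "uniformly_Cauchy_on K s"
    unfolding uniformly_Cauchy_on_def
  proof (intro allI impI)
    fix e :: real assume e: "e > 0"
    then obtain N where N: "\<And>m n. m \<ge> N \<Longrightarrow> n \<ge> N \<Longrightarrow> real_energy q (\<lambda>x. s m x - s n x) < (e/5)\<^sup>2"
      using C[of "(e/5)\<^sup>2"] by auto
    have "dist (s m x) (s n x) < e" if "x \<in> K" "m \<ge> N" "n \<ge> N" for x m n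
    proof -
      have "sqrt (real_energy q (\<lambda>x. s m x - s n x)) < e/5"
        using N[OF that(2,3)] e by (intro real_less_lsqrt) auto
      then show ?thesis
        using W0_sup_bound[OF W0_diff[OF s[of m] s[of n]] that(1)] by (simp add: dist_real_def)
    qed
    then show "\<exists>N. \<forall>x\<in>K. \<forall>m\<ge>N. \<forall>n\<ge>N. dist (s m x) (s n x) < e" by blast
  qed
  then obtain u where u: "uniform_limit K s u sequentially"
    using Cauchy_uniformly_convergent unfolding uniformly_convergent_on_def by blast
  have lim: "(\<lambda>n. s n x) \<longlonglongrightarrow> u x" if "x \<in> K" for x
    using tendsto_uniform_limitI[OF u that] .
  have cont: "continuous_on K u"
    by (rule uniform_limit_theorem[OF _ u]) (use s W0_W W_continuous in \<open>auto intro!: always_eventually\<close>)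
  \<comment> \<open>At a fixed level the graph energy is a finite sum, so pointwise convergence
    suffices to let \<open>m\<close> tend to infinity; \<open>e\<close> does not depend on
    \<open>k\<close>.\<close>
  have ge: "graph_energy q k (\<lambda>x. s n x - u x) \<le> e"
    if N: "\<And>m n. m \<ge> N \<Longrightarrow> n \<ge> N \<Longrightarrow> real_energy q (\<lambda>x. s m x - s n x) < e" and n: "n \<ge> N" for N n e k
  proof (rule LIMSEQ_le_const2)
    show "(\<lambda>m. graph_energy q k (\<lambda>x. s n x - s m x)) \<longlonglongrightarrow> graph_energy q k (\<lambda>x. s n x - u x)"
      unfolding graph_energy_def
    proof (intro tendsto_intros)
      fix p assume "p \<in> {(x, y). sg_adj q k x y}"
      then obtain x y where p: "p = (x, y)" "sg_adj q k x y" by auto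
      then have xy: "p = (x, y)" "x \<in> K" "y \<in> K"
        using sg_adj_in_V[OF p(2)] sg_V_subset_SG[of q k] by auto
      show "(\<lambda>m. case p of (x, y) \<Rightarrow> (s n x - s m x - (s n y - s m y))\<^sup>2) \<longlonglongrightarrow>
          (case p of (x, y) \<Rightarrow> (s n x - u x - (s n y - u y))\<^sup>2)"
        unfolding xy(1) prod.case by (intro tendsto_intros lim xy)
    qed
    have "graph_energy q k (\<lambda>x. s n x - s m x) \<le> e" if "m \<ge> N" for m
      using graph_energy_le_real_energy[OF energy_bounded_diff[OF W0_bounded[OF s[of n]] W0_bounded[OF s[of m]]], of k]
        N[OF n that] by linarith
    then show "\<exists>N. \<forall>m\<ge>N. graph_energy q k (\<lambda>x. s n x - s m x) \<le> e" by blast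
  qed
  obtain N where N: "\<And>m n. m \<ge> N \<Longrightarrow> n \<ge> N \<Longrightarrow> real_energy q (\<lambda>x. s m x - s n x) < 1"
    using C[of 1] by auto
  have "energy_bounded q (\<lambda>x. s N x - u x)"
    unfolding energy_bounded_def using ge[OF N order_refl] by blast
  then have "energy_bounded q (\<lambda>x. s N x - (s N x - u x))"
    by (rule energy_bounded_diff[OF W0_bounded[OF s]])
  then have bdd: "energy_bounded q u" by simp
  have "u (q i) = 0" if "i < 3" for i
    using lim[OF vertex_in_SG[OF that]] s that by (simp add: W0_def LIMSEQ_const_iff)
  then have u0: "u \<in> W0" using cont bdd unfolding W0_def W_def by simp
  have "(\<lambda>n. real_energy q (\<lambda>x. s n x - u x)) \<longlonglongrightarrow> 0"
  proof (rule LIMSEQ_I)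
    fix e :: real assume e: "e > 0"
    then obtain N where N: "\<And>m n. m \<ge> N \<Longrightarrow> n \<ge> N \<Longrightarrow> real_energy q (\<lambda>x. s m x - s n x) < e/2"
      using C[of "e/2"] by auto
    have "norm (real_energy q (\<lambda>x. s n x - u x) - 0) < e" if n: "n \<ge> N" for n
    proof -
      have b: "energy_bounded q (\<lambda>x. s n x - u x)"
        by (intro energy_bounded_diff W0_bounded s u0)
      have "real_energy q (\<lambda>x. s n x - u x) \<le> e/2"
        by (rule LIMSEQ_le_const2[OF graph_energy_tendsto[OF b]]) (use ge[OF N n] in auto)
      then show ?thesis using real_energy_nonneg[OF b] e by simp
    qed
    then show "\<exists>N. \<forall>n\<ge>N. norm (real_energy q (\<lambda>x. s n x - u x) - 0) < e" by blast
  qed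
  with u0 show thesis by (rule that)
qed

text \<open>At \<open>t = - b / (e + 1)\<close> the expression equals
  \<open>- (c\<^sup>2 * (e + 2))\<close> with \<open>c = b / (e + 1)\<close>. The summand 1 covers
  the case \<open>e = 0\<close>.\<close>

lemma quadratic_nonneg_imp_zero:
  fixes b e :: real
  assumes "\<And>t. 0 \<le> 2 * t * b + t\<^sup>2 * e" "e \<ge> 0" shows "b = 0"
proof -
  define c where "c = b / (e + 1)"
  have b: "b = c * (e + 1)" using assms(2) by (simp add: c_def)
  have "0 \<le> 2 * (- c) * b + (- c)\<^sup>2 * e" by (rule assms)
  also have "\<dots> = - (c\<^sup>2 * (e + 2))" unfolding b by (simp add: power2_eq_square algebra_simps)
  finally have "c\<^sup>2 * (e + 2) \<le> 0" by simp
  then have "c = 0" using assms(2) by (simp add: mult_le_0_iff)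
  then show ?thesis by (simp add: b)
qed

text \<open>The representer is the limit of a minimizing sequence for the energy minus twice
  \<open>\<phi>\<close>.\<close>

lemma W0_Riesz:
  assumes add: "\<And>u v. u \<in> W0 \<Longrightarrow> v \<in> W0 \<Longrightarrow> \<phi> (\<lambda>x. u x + v x) = \<phi> u + \<phi> v"
    and scale: "\<And>c u. u \<in> W0 \<Longrightarrow> \<phi> (\<lambda>x. c * u x) = c * \<phi> u"
    and bound: "\<And>v. v \<in> W0 \<Longrightarrow> \<bar>\<phi> v\<bar> \<le> C * sqrt (real_energy q v)"
  obtains g where "g \<in> W0" "\<And>v. v \<in> W0 \<Longrightarrow> energy_form q g v = \<phi> v"
proof -
  define J where "J v = real_energy q v - 2 * \<phi> v" for v
  define I where "I = Inf (J ` W0)"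
  have "J v \<ge> - C\<^sup>2" if v: "v \<in> W0" for v
  proof -
    have "0 \<le> (sqrt (real_energy q v) - C)\<^sup>2" by simp
    also have "\<dots> = real_energy q v - 2 * (C * sqrt (real_energy q v)) + C\<^sup>2"
      using real_energy_nonneg[OF W0_bounded[OF v]] by (simp add: power2_diff)
    finally show ?thesis using bound[OF v] unfolding J_def by linarith
  qed
  then have bdd: "bdd_below (J ` W0)" by (intro bdd_belowI2)
  have J_ge: "I \<le> J v" if "v \<in> W0" for v
    unfolding I_def by (rule cINF_lower[OF bdd that])
  have "\<exists>v\<in>W0. J v < I + 1 / real (Suc n)" for n
    using cInf_lessD[of "J ` W0" "I + 1 / real (Suc n)"] zero_in_W0 unfolding I_def by auto
  then obtain s where s: "\<And>n. s n \<in> W0" and Js: "\<And>n. J (s n) < I + 1 / real (Suc n)"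
    by metis
  have sb: "energy_bounded q (s n)" for n by (rule W0_bounded[OF s])
  \<comment> \<open>Parallelogram identity: the linear parts cancel, and the midpoint of two
    near-minimizers cannot go below \<open>I\<close>.\<close>
  have close: "real_energy q (\<lambda>x. s m x - s n x) < 2 / real (Suc m) + 2 / real (Suc n)" for m n
  proof -
    have mid: "(\<lambda>x. 1/2 * (s m x + s n x)) \<in> W0" by (intro W0_scale W0_add s)
    have "J (\<lambda>x. 1/2 * (s m x + s n x))
        = (real_energy q (s m) + 2 * energy_form q (s m) (s n) + real_energy q (s n)) / 4 - \<phi> (s m) - \<phi> (s n)"
      unfolding J_def scale[OF W0_add[OF s s]] add[OF s s]
        real_energy_scale[OF W0_bounded[OF W0_add[OF s s]]] real_energy_add[OF sb sb]
      by (simp add: power2_eq_square field_simps)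
    then have "real_energy q (\<lambda>x. s m x - s n x)
        = 2 * J (s m) + 2 * J (s n) - 4 * J (\<lambda>x. 1/2 * (s m x + s n x))"
      using J_def[of "s m"] J_def[of "s n"] real_energy_diff[OF sb sb, of m n] by argo
    then show ?thesis using Js[of m] Js[of n] J_ge[OF mid] by linarith
  qed
  obtain g where g: "g \<in> W0" "(\<lambda>n. real_energy q (\<lambda>x. s n x - g x)) \<longlonglongrightarrow> 0"
  proof (rule W0_complete[OF s])
    fix e :: real assume e: "e > 0"
    obtain N where N: "1 / real (Suc N) < e / 4" using nat_approx_posE[of "e/4"] e by auto
    have "real_energy q (\<lambda>x. s m x - s n x) < e" if "m \<ge> N" "n \<ge> N" for m n
    proof -
      have "2 / real (Suc m) \<le> 2 / real (Suc N)" "2 / real (Suc n) \<le> 2 / real (Suc N)"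
        using that by (auto intro!: divide_left_mono)
      then show ?thesis using close[of m n] N by simp
    qed
    then show "\<exists>N. \<forall>m\<ge>N. \<forall>n\<ge>N. real_energy q (\<lambda>x. s m x - s n x) < e" by blast
  qed (rule that)
  have "energy_form q g v = \<phi> v" if v: "v \<in> W0" for v
  proof -
    have vb: "energy_bounded q v" and gb: "energy_bounded q g" using v g(1) by (auto intro: W0_bounded)
    have "(\<lambda>n. sqrt (real_energy q (\<lambda>x. s n x - g x) * real_energy q v)) \<longlonglongrightarrow> sqrt (0 * real_energy q v)"
      by (intro tendsto_intros g)
    then have "(\<lambda>n. sqrt (real_energy q (\<lambda>x. s n x - g x) * real_energy q v)) \<longlonglongrightarrow> 0" by simp
    then have "(\<lambda>n. energy_form q (\<lambda>x. s n x - g x) v) \<longlonglongrightarrow> 0"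
    proof (rule Lim_null_comparison[rotated])
      show "\<forall>\<^sub>F n in sequentially. norm (energy_form q (\<lambda>x. s n x - g x) v)
          \<le> sqrt (real_energy q (\<lambda>x. s n x - g x) * real_energy q v)"
        using energy_form_Cauchy_Schwarz[OF energy_bounded_diff[OF sb gb] vb]
        by (auto intro!: always_eventually real_le_rsqrt)
    qed
    then have "(\<lambda>n. energy_form q g v + energy_form q (\<lambda>x. s n x - g x) v) \<longlonglongrightarrow> energy_form q g v + 0"
      by (intro tendsto_intros)
    then have lim: "(\<lambda>n. energy_form q (s n) v) \<longlonglongrightarrow> energy_form q g v"
      unfolding energy_form_diff_left[OF sb gb vb] by simp
    \<comment> \<open>The variation is taken at \<open>s n\<close>, which is minimal up to
      \<open>1 / real (Suc n)\<close>, and the inequality then passes to the limit.\<close>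
    have "0 \<le> 2 * t * (energy_form q g v - \<phi> v) + t\<^sup>2 * real_energy q v" for t
    proof (rule LIMSEQ_le)
      show "(\<lambda>n. - (1 / real (Suc n))) \<longlonglongrightarrow> 0"
        using tendsto_minus[OF LIMSEQ_inverse_real_of_nat] by (simp add: inverse_eq_divide)
      show "(\<lambda>n. 2 * t * (energy_form q (s n) v - \<phi> v) + t\<^sup>2 * real_energy q v) \<longlonglongrightarrow>
          2 * t * (energy_form q g v - \<phi> v) + t\<^sup>2 * real_energy q v"
        by (intro tendsto_intros lim)
      have "- (1 / real (Suc n)) \<le> 2 * t * (energy_form q (s n) v - \<phi> v) + t\<^sup>2 * real_energy q v" for n
      proof -
        have "energy_form q (s n) (\<lambda>x. t * v x) = t * energy_form q (s n) v"
          using energy_form_scale_left[OF vb sb, of t] by (simp add: energy_form_commute)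
        then have "J (\<lambda>x. s n x + t * v x)
            = J (s n) + 2 * t * (energy_form q (s n) v - \<phi> v) + t\<^sup>2 * real_energy q v"
          unfolding J_def add[OF s W0_scale[OF v]] scale[OF v]
            real_energy_add[OF sb energy_bounded_scale[OF vb]] real_energy_scale[OF vb]
          by (simp add: algebra_simps)
        then show ?thesis using J_ge[OF W0_add[OF s W0_scale[OF v]], of n t] Js[of n] by linarith
      qed
      then show "\<exists>N. \<forall>n\<ge>N. - (1 / real (Suc n)) \<le> 2 * t * (energy_form q (s n) v - \<phi> v) + t\<^sup>2 * real_energy q v"
        by blast
    qed
    then show ?thesis
      using quadratic_nonneg_imp_zero[of "energy_form q g v - \<phi> v" "real_energy q v"]
        real_energy_nonneg[OF vb] by auto
  qed
  with g(1) show thesis by (rule that)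
qed

lemma point_evaluation_representer:
  assumes "x \<in> K" obtains g where "g \<in> W0" "\<And>v. v \<in> W0 \<Longrightarrow> energy_form q g v = v x"
  by (rule W0_Riesz[of "\<lambda>v. v x" 5]) (use W0_sup_bound[OF _ assms] in auto)

text \<open>Another candidate differs from \<open>h\<close> by an element of \<open>W0\<close>,
  which is orthogonal to \<open>h\<close>, so its energy is that of \<open>h\<close> plus the energy
  of the difference. This gives minimality and uniqueness at once.\<close>

lemma harmonic_basis_restrict:
  assumes h: "h \<in> W" "\<And>i. i < 3 \<Longrightarrow> h (q i) = (if i = j then 1 else 0)"
    "\<And>v. v \<in> W0 \<Longrightarrow> energy_form q h v = 0"
  shows "harmonic_basis q j = restrict h K"
proof -
  let ?h = "restrict h K"
  have hK: "x \<in> K \<Longrightarrow> ?h x = h x" for x by simp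
  have hW: "?h \<in> W" using h(1) by (simp add: restrict_W_iff)
  have orth: "energy_form q ?h v = 0" if "v \<in> W0" for v
    using h(3)[OF that] energy_form_cong[of ?h h v v] by simp
  have cand: "?h \<in> harmonic_candidates q j"
    using hW h(2) by (simp add: harmonic_candidates_def dom_energy_iff W_def vertex_in_SG)
  have diff: "(\<lambda>x. u x - ?h x) \<in> W0" and uW: "u \<in> W"
    and split: "real_energy q u = real_energy q ?h + real_energy q (\<lambda>x. u x - ?h x)"
    if u: "u \<in> harmonic_candidates q j" for u
  proof -
    show uW: "u \<in> W" using u by (simp add: harmonic_candidates_def dom_energy_iff W_def)
    show d: "(\<lambda>x. u x - ?h x) \<in> W0"
      unfolding W0_def using W_diff[OF uW hW] u cand by (simp add: harmonic_candidates_def)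
    show "real_energy q u = real_energy q ?h + real_energy q (\<lambda>x. u x - ?h x)"
      using real_energy_add[OF W_bounded[OF hW] W0_bounded[OF d]] orth[OF d] by simp
  qed
  show ?thesis
    unfolding harmonic_basis_def
  proof (rule the_equality)
    have "energy q ?h \<le> energy q u" if u: "u \<in> harmonic_candidates q j" for u
      using split[OF u] real_energy_nonneg[OF W0_bounded[OF diff[OF u]]]
      by (auto simp: energy_eq W_bounded hW uW[OF u] intro!: ennreal_leI)
    then show "?h \<in> harmonic_candidates q j \<and> (\<forall>u\<in>harmonic_candidates q j. energy q ?h \<le> energy q u)"
      using cand by blast
    fix k assume k: "k \<in> harmonic_candidates q j \<and> (\<forall>u\<in>harmonic_candidates q j. energy q k \<le> energy q u)"
    then have "energy q k \<le> energy q ?h" using cand by blast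
    then have "real_energy q k \<le> real_energy q ?h"
      using k hW uW by (simp add: energy_eq W_bounded real_energy_nonneg)
    then have "real_energy q (\<lambda>x. k x - ?h x) \<le> 0" using split k by fastforce
    then have "k x = ?h x" if "x \<in> K" for x
      using W0_eq_zero[OF diff _ that] k by fastforce
    moreover have "k \<in> extensional K" using k by (simp add: harmonic_candidates_def dom_energy_def)
    ultimately show "k = ?h" by (intro extensionalityI[of _ K]) auto
  qed
qed

text \<open>Start from a finite-energy \<open>f\<close> with the required vertex values and subtract
  its energy-orthogonal projection \<open>g\<close> onto \<open>W0\<close>, obtained from the Riesz
  lemma.\<close>

lemma harmonic_basis_properties:
  shows harmonic_basis_W: "harmonic_basis q j \<in> W"
    and harmonic_basis_vertex: "i < 3 \<Longrightarrow> harmonic_basis q j (q i) = (if i = j then 1 else 0)"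
    and harmonic_basis_orthogonal: "v \<in> W0 \<Longrightarrow> energy_form q (harmonic_basis q j) v = 0"
proof -
  define f where "f = harmonic (\<lambda>i. if i = j then 1 else 0)"
  have f: "f \<in> W" "\<And>i. i < 3 \<Longrightarrow> f (q i) = (if i = j then 1 else 0)"
    unfolding f_def W_def by (simp_all add: continuous_on_harmonic energy_bounded_harmonic harmonic_vertex)
  have fb: "energy_bounded q f" by (rule W_bounded[OF f(1)])
  obtain g where g: "g \<in> W0" "\<And>v. v \<in> W0 \<Longrightarrow> energy_form q g v = energy_form q v f"
  proof (rule W0_Riesz[of "\<lambda>v. energy_form q v f" "sqrt (real_energy q f)"])
    fix v assume v: "v \<in> W0"
    have "\<bar>energy_form q v f\<bar> \<le> sqrt (real_energy q v * real_energy q f)"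
      using energy_form_Cauchy_Schwarz[OF W0_bounded[OF v] fb] by (intro real_le_rsqrt) simp
    then show "\<bar>energy_form q v f\<bar> \<le> sqrt (real_energy q f) * sqrt (real_energy q v)"
      by (simp add: real_sqrt_mult mult.commute)
  qed (auto simp: energy_form_add_left energy_form_scale_left W0_bounded fb intro: that)
  define h where "h x = f x - g x" for x
  have h: "h \<in> W" unfolding h_def using W_diff[OF f(1) W0_W[OF g(1)]] .
  have hv: "h (q i) = (if i = j then 1 else 0)" if "i < 3" for i
    using f(2)[OF that] g(1) that by (simp add: h_def W0_def)
  have ho: "energy_form q h v = 0" if "v \<in> W0" for v
    using energy_form_diff_left[OF fb W0_bounded[OF g(1)] W0_bounded[OF that]] g(2)[OF that]
    by (simp add: h_def[abs_def] energy_form_commute[of v])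
  have eq: "harmonic_basis q j = restrict h K" by (rule harmonic_basis_restrict[OF h hv ho])
  have hK: "x \<in> K \<Longrightarrow> restrict h K x = h x" for x by simp
  show "harmonic_basis q j \<in> W" unfolding eq restrict_W_iff by (rule h)
  show "i < 3 \<Longrightarrow> harmonic_basis q j (q i) = (if i = j then 1 else 0)"
    unfolding eq using hv by (simp add: vertex_in_SG)
  show "v \<in> W0 \<Longrightarrow> energy_form q (harmonic_basis q j) v = 0"
    unfolding eq using ho energy_form_cong[of "restrict h K" h v v] by simp
qed

text \<open>The projection of \<open>u\<close> onto the harmonic functions, the energy-orthogonal
  complement of \<open>W0\<close> in \<open>W\<close>.\<close>

definition harmonic_part :: "(real^2 \<Rightarrow> real) \<Rightarrow> real^2 \<Rightarrow> real" where
  "harmonic_part u x = (\<Sum>j<3. u (q j) * harmonic_basis q j x)"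

lemma harmonic_part_W: "harmonic_part u \<in> W"
  unfolding harmonic_part_def[abs_def] by (intro W_sum harmonic_basis_W) simp

lemma harmonic_part_vertex: "i < 3 \<Longrightarrow> harmonic_part u (q i) = u (q i)"
proof -
  assume i: "i < 3"
  have "harmonic_part u (q i) = (\<Sum>j<3. if j = i then u (q j) else 0)"
    unfolding harmonic_part_def by (intro sum.cong refl) (simp add: harmonic_basis_vertex i)
  then show ?thesis using i by simp
qed

lemma harmonic_part_orthogonal: "v \<in> W0 \<Longrightarrow> energy_form q (harmonic_part u) v = 0"
  unfolding harmonic_part_def[abs_def]
  by (subst energy_form_sum_left)
    (simp_all add: W0_bounded W_bounded harmonic_basis_W harmonic_basis_orthogonal)

lemma diff_harmonic_part_W0: "u \<in> W \<Longrightarrow> (\<lambda>x. u x - harmonic_part u x) \<in> W0"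
  by (simp add: W0_def W_diff harmonic_part_W harmonic_part_vertex)

text \<open>The difference from the harmonic part lies in \<open>W0\<close> and is orthogonal to
  \<open>W0\<close>, hence to itself.\<close>

lemma orthogonal_imp_harmonic:
  assumes u: "u \<in> W" "\<And>v. v \<in> W0 \<Longrightarrow> energy_form q u v = 0" and x: "x \<in> K"
  shows "u x = harmonic_part u x"
proof -
  let ?d = "\<lambda>x. u x - harmonic_part u x"
  have d: "?d \<in> W0" by (rule diff_harmonic_part_W0[OF u(1)])
  have "energy_form q ?d ?d = 0"
    using energy_form_diff_left[OF W_bounded[OF u(1)] W_bounded[OF harmonic_part_W] W0_bounded[OF d]]
    by (simp add: u(2)[OF d] harmonic_part_orthogonal[OF d])
  then show ?thesis
    using W0_eq_zero[OF d _ x] energy_form_self[OF W0_bounded[OF d]] by simp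
qed

end

section \<open>Square-integrable functions on the gasket\<close>

locale gasket_measure = gasket +
  fixes \<zeta> :: "(real^2) measure"
  assumes measure: "finite_positive_continuous_measure q \<zeta>"
begin

lemma sets_measure: "sets \<zeta> = sets (restrict_space borel K)"
  using measure by (simp add: finite_positive_continuous_measure_def)

lemma space_measure: "space \<zeta> = K"
  using sets_eq_imp_space_eq[OF sets_measure] by (simp add: space_restrict_space)

sublocale finite_measure \<zeta>
  using measure by (simp add: finite_positive_continuous_measure_def)

lemma sets_measure_iff: "A \<in> sets \<zeta> \<longleftrightarrow> (\<exists>B\<in>sets borel. A = B \<inter> K)"
  unfolding sets_measure sets_restrict_space by auto

lemma borel_measurable_continuous: "continuous_on K f \<Longrightarrow> f \<in> borel_measurable \<zeta>" for f :: "real^2 \<Rightarrow> real"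
  unfolding measurable_cong_sets[OF sets_measure refl] by (rule borel_measurable_continuous_on_restrict)

lemma continuous_bounded:
  fixes f :: "real^2 \<Rightarrow> real"
  assumes "continuous_on K f" obtains C where "C > 0" "\<And>x. x \<in> K \<Longrightarrow> \<bar>f x\<bar> \<le> C"
  using compact_imp_bounded[OF compact_continuous_image[OF assms compact_SG]]
  unfolding bounded_pos by auto

definition L2 :: "(real^2 \<Rightarrow> real) \<Rightarrow> bool" where
  "L2 f \<longleftrightarrow> f \<in> borel_measurable \<zeta> \<and> integrable \<zeta> (\<lambda>x. (f x)\<^sup>2)"

lemma L2_continuous:
  assumes f: "continuous_on K f" shows "L2 f"
proof -
  obtain C where C: "C > 0" "\<And>x. x \<in> K \<Longrightarrow> \<bar>f x\<bar> \<le> C"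
    using continuous_bounded[OF f] by blast
  have "integrable \<zeta> (\<lambda>x. (f x)\<^sup>2)"
  proof (rule integrable_const_bound[of _ "C\<^sup>2"])
    show "AE x in \<zeta>. norm ((f x)\<^sup>2) \<le> C\<^sup>2"
      using C by (intro AE_I2) (simp add: space_measure abs_le_square_iff[symmetric])
    show "(\<lambda>x. (f x)\<^sup>2) \<in> borel_measurable \<zeta>"
      using borel_measurable_continuous[OF f] by measurable
  qed
  then show ?thesis by (simp add: L2_def borel_measurable_continuous[OF f])
qed

lemma L2_mult:
  assumes f: "L2 f" and g: "L2 g" shows "integrable \<zeta> (\<lambda>x. f x * g x)"
proof (rule Bochner_Integration.integrable_bound)
  show "integrable \<zeta> (\<lambda>x. (f x)\<^sup>2 + (g x)\<^sup>2)" using f g by (simp add: L2_def)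
  show "(\<lambda>x. f x * g x) \<in> borel_measurable \<zeta>"
    using f g unfolding L2_def by (auto intro: borel_measurable_times)
  have "\<bar>s * t\<bar> \<le> s\<^sup>2 + t\<^sup>2" for s t :: real
  proof -
    have "0 \<le> (\<bar>s\<bar> - \<bar>t\<bar>)\<^sup>2" by simp
    then have "2 * \<bar>s * t\<bar> \<le> s\<^sup>2 + t\<^sup>2" by (simp add: power2_diff abs_mult)
    then show ?thesis using abs_ge_zero[of "s * t"] by linarith
  qed
  then show "AE x in \<zeta>. norm (f x * g x) \<le> norm ((f x)\<^sup>2 + (g x)\<^sup>2)"
    by (intro AE_I2) simp
qed

lemma L2_diff:
  assumes f: "L2 f" and g: "L2 g" shows "L2 (\<lambda>x. f x - g x)"
proof -
  have "integrable \<zeta> (\<lambda>x. (f x)\<^sup>2 - 2 * (f x * g x) + (g x)\<^sup>2)"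
    using L2_mult[OF f g] f g by (simp add: L2_def)
  then have "integrable \<zeta> (\<lambda>x. (f x - g x)\<^sup>2)"
    by (simp add: power2_diff algebra_simps)
  then show ?thesis using f g unfolding L2_def by (auto intro: borel_measurable_diff)
qed

lemma L2_integrable: "L2 f \<Longrightarrow> integrable \<zeta> f"
  using L2_mult[OF _ L2_continuous[of "\<lambda>x. 1"], of f] by simp

text \<open>Absence of atoms enters here. Functions in \<open>W0\<close> vanish on
  \<open>V 0\<close>, so approximation of indicators by them may fail there.\<close>

lemma AE_not_vertex: "AE x in \<zeta>. x \<notin> V 0"
proof -
  have "AE x in \<zeta>. x \<noteq> q i" if i: "i < 3" for i
  proof (rule AE_I'[of "{q i}"])
    have "{q i} = {q i} \<inter> K" using vertex_in_SG[OF i] by auto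
    then have "{q i} \<in> sets \<zeta>" unfolding sets_measure_iff by (intro bexI[of _ "{q i}"]) auto
    then show "{q i} \<in> null_sets \<zeta>"
      using measure vertex_in_SG[OF i] by (simp add: finite_positive_continuous_measure_def null_sets_def)
  qed auto
  from this[of 0] this[of 1] this[of 2] show ?thesis
    by (simp add: lessThan_3)
qed

section \<open>Functions orthogonal to all of \<open>W0\<close>\<close>

lemma cells_small: "r > 0 \<Longrightarrow> \<forall>\<^sub>F n in sequentially. diameter K / 2 ^ n < r"
  by (rule order_tendstoD(2)[OF LIMSEQ_divide_realpow_zero]) auto

lemma cell_vertex_near:
  assumes w: "w \<in> sg_words n" and x: "x \<in> sg_word_map q w ` K" and p: "p \<in> sg_word_map q w ` K"
  shows "dist x p \<le> diameter K / 2 ^ n"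
proof -
  obtain y z where "y \<in> K" "z \<in> K" "x = sg_word_map q w y" "p = sg_word_map q w z"
    using x p by blast
  then show ?thesis
    using diameter_bounded_bound[OF compact_imp_bounded[OF compact_SG[of q]], of y z]
    by (simp add: sg_word_map_dist[OF w] divide_right_mono)
qed

text \<open>Mark the vertices of level \<open>n\<close> close to \<open>A\<close> and extend. A
  small cell around \<open>x\<close> has all corners marked if \<open>x\<close> lies in
  \<open>A\<close>, and none if it does not, so the extension is eventually constant at
  \<open>x\<close>.\<close>

lemma indicator_approx:
  assumes A: "closed A"
  obtains v where "\<And>n. v n \<in> W0" "\<And>n x. 0 \<le> v n x \<and> v n x \<le> 1"
    "\<And>x. x \<in> K \<Longrightarrow> x \<notin> V 0 \<Longrightarrow> (\<lambda>n. v n x) \<longlonglongrightarrow> indicator A x"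
proof -
  \<comment> \<open>The threshold is the diameter bound for a cell of level \<open>n\<close>:
    corners of a cell meeting \<open>A\<close> on the gasket are within it. Excluding
    \<open>V 0\<close> places the extension in \<open>W0\<close>.\<close>
  define u :: "nat \<Rightarrow> real^2 \<Rightarrow> real" where
    "u n p = (if p \<notin> V 0 \<and> (\<exists>a\<in>A \<inter> K. dist p a \<le> diameter K / 2 ^ n) then 1 else 0)" for n p
  have "\<exists>v. continuous_on K v \<and> energy_bounded q v \<and> (\<forall>x\<in>V n. v x = u n x) \<and> (\<forall>x. 0 \<le> v x \<and> v x \<le> 1) \<and>
    (\<forall>w\<in>sg_words n. \<forall>c\<in>{0,1}. (\<forall>p\<in>sg_word_map q w ` V 0. u n p = c) \<longrightarrow> (\<forall>x\<in>sg_word_map q w ` K. v x = c))" for n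
  proof -
    obtain v where v: "continuous_on K v" "energy_bounded q v" "\<And>x. x \<in> V n \<Longrightarrow> v x = u n x"
      "\<And>x. 0 \<le> v x \<and> v x \<le> 1"
      "\<And>w c x. w \<in> sg_words n \<Longrightarrow> c = 0 \<or> c = 1 \<Longrightarrow> (\<And>p. p \<in> sg_word_map q w ` V 0 \<Longrightarrow> u n p = c) \<Longrightarrow>
        x \<in> sg_word_map q w ` K \<Longrightarrow> v x = c"
      by (rule extension_unit_interval[of n "u n"]) (auto simp: u_def)
    show ?thesis
      by (intro exI[of _ v] conjI ballI allI impI v) auto
  qed
  then obtain v where v: "\<forall>n. continuous_on K (v n) \<and> energy_bounded q (v n) \<and> (\<forall>x\<in>V n. v n x = u n x) \<and>
    (\<forall>x. 0 \<le> v n x \<and> v n x \<le> 1) \<and>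
    (\<forall>w\<in>sg_words n. \<forall>c\<in>{0,1}. (\<forall>p\<in>sg_word_map q w ` V 0. u n p = c) \<longrightarrow> (\<forall>x\<in>sg_word_map q w ` K. v n x = c))"
    by (rule choice[OF allI, THEN exE])
  have cell: "v n x = c" if "w \<in> sg_words n" "c = 0 \<or> c = 1"
    "\<And>p. p \<in> sg_word_map q w ` V 0 \<Longrightarrow> u n p = c" "x \<in> sg_word_map q w ` K" for n w c x
  proof -
    have "\<forall>c\<in>{0,1}. (\<forall>p\<in>sg_word_map q w ` V 0. u n p = c) \<longrightarrow> (\<forall>x\<in>sg_word_map q w ` K. v n x = c)"
      using v that(1) by blast
    then show ?thesis using that(2-4) by blast
  qed
  have V0K: "V 0 \<subseteq> K" by (rule sg_V_subset_SG)
  show thesis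
  proof (rule that[of v])
    fix n
    have "v n (q i) = 0" if "i < 3" for i
    proof -
      have "q i \<in> V n" "q i \<in> V 0" using vertex_in_sg_V that by auto
      then show ?thesis using v by (simp add: u_def)
    qed
    then show "v n \<in> W0" using v unfolding W0_def W_def by simp
    show "0 \<le> v n x \<and> v n x \<le> 1" for x using v by simp
  next
    fix x assume x: "x \<in> K" "x \<notin> V 0"
    show "(\<lambda>n. v n x) \<longlonglongrightarrow> indicator A x"
    proof (cases "x \<in> A")
      case True
      obtain r where r: "r > 0" "\<And>p. p \<in> V 0 \<Longrightarrow> r \<le> dist x p"
        using separate_point_closed[of "V 0" x] x(2) finite_imp_closed[OF finite_sg_V[of q 0]] by metis
      have "v n x = 1" if n: "diameter K / 2 ^ n < r" for n
      proof -
        obtain w where w: "w \<in> sg_words n" "x \<in> sg_word_map q w ` K"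
          using SG_cell_cover[OF x(1)] by blast
        show ?thesis
        proof (rule cell[OF w(1) _ _ w(2)])
          fix p assume "p \<in> sg_word_map q w ` V 0"
          then have d: "dist x p \<le> diameter K / 2 ^ n"
            using V0K by (intro cell_vertex_near[OF w]) blast
          then have "p \<notin> V 0" using r(2)[of p] n by auto
          then show "u n p = 1" unfolding u_def using d True x(1) by (auto simp: dist_commute)
        qed simp
      qed
      then have "\<forall>\<^sub>F n in sequentially. v n x = 1"
        using cells_small[OF r(1)] by (auto elim!: eventually_mono)
      then show ?thesis using True by (simp add: tendsto_eventually)
    next
      case False
      obtain r where r: "r > 0" "\<And>a. a \<in> A \<inter> K \<Longrightarrow> r \<le> dist x a"
        using separate_point_closed[of "A \<inter> K" x] False closed_Int[OF A closed_SG[of q]] by auto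
      \<comment> \<open>One half of \<open>r\<close> covers the way from \<open>x\<close> to the
        corner, the other half the way from the corner to \<open>A\<close>.\<close>
      have "v n x = 0" if n: "diameter K / 2 ^ n < r / 2" for n
      proof -
        obtain w where w: "w \<in> sg_words n" "x \<in> sg_word_map q w ` K"
          using SG_cell_cover[OF x(1)] by blast
        show ?thesis
        proof (rule cell[OF w(1) _ _ w(2)])
          fix p assume "p \<in> sg_word_map q w ` V 0"
          then have d: "dist x p \<le> diameter K / 2 ^ n"
            using V0K by (intro cell_vertex_near[OF w]) blast
          have "\<not> dist p a \<le> diameter K / 2 ^ n" if "a \<in> A \<inter> K" for a
            using r(2)[OF that] d n dist_triangle[of x a p] by linarith
          then show "u n p = 0" unfolding u_def by auto
        qed simp
      qed
      then have "\<forall>\<^sub>F n in sequentially. v n x = 0"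
        using cells_small[of "r / 2"] r(1) by (auto elim!: eventually_mono)
      then show ?thesis using False by (simp add: tendsto_eventually)
    qed
  qed
qed

lemma closed_integral_zero:
  assumes f: "L2 f" and orth: "\<And>v. v \<in> W0 \<Longrightarrow> (\<integral>x. f x * v x \<partial>\<zeta>) = 0" and A: "closed A"
  shows "(\<integral>x. f x * indicator A x \<partial>\<zeta>) = 0"
proof -
  obtain v where v: "\<And>n. v n \<in> W0" "\<And>n x. 0 \<le> v n x \<and> v n x \<le> 1"
    "\<And>x. x \<in> K \<Longrightarrow> x \<notin> V 0 \<Longrightarrow> (\<lambda>n. v n x) \<longlonglongrightarrow> indicator A x"
    using indicator_approx[OF A] by blast
  have fm: "f \<in> borel_measurable \<zeta>" using f by (simp add: L2_def)
  have "(\<lambda>n. \<integral>x. f x * v n x \<partial>\<zeta>) \<longlonglongrightarrow> (\<integral>x. f x * indicator A x \<partial>\<zeta>)"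
  proof (rule integral_dominated_convergence[where w = "\<lambda>x. \<bar>f x\<bar>"])
    have "(indicator A :: real^2 \<Rightarrow> real) \<in> borel_measurable \<zeta>"
      unfolding measurable_cong_sets[OF sets_measure refl]
      by (intro measurable_restrict_space1 borel_measurable_indicator) (use A in auto)
    then show "(\<lambda>x. f x * indicator A x) \<in> borel_measurable \<zeta>" using fm by measurable
    show "(\<lambda>x. f x * v n x) \<in> borel_measurable \<zeta>" for n
      using fm borel_measurable_continuous[OF W_continuous[OF W0_W[OF v(1)]], of n] by measurable
    show "integrable \<zeta> (\<lambda>x. \<bar>f x\<bar>)" using L2_integrable[OF f] by simp
    show "AE x in \<zeta>. (\<lambda>n. f x * v n x) \<longlonglongrightarrow> f x * indicator A x"
      using AE_not_vertex by (rule AE_mp) (auto intro!: AE_I2 tendsto_mult_left v(3) simp: space_measure)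
    show "AE x in \<zeta>. norm (f x * v n x) \<le> \<bar>f x\<bar>" for n
    proof (intro AE_I2)
      fix x show "norm (f x * v n x) \<le> \<bar>f x\<bar>"
        using v(2)[of n x] mult_left_le[of "v n x" "\<bar>f x\<bar>"] by (simp add: abs_mult)
    qed
  qed
  then show ?thesis by (simp add: orth v(1) LIMSEQ_const_iff)
qed

text \<open>Closed sets are stable under intersection and generate the Borel sets, so the integral
  of \<open>f\<close> vanishes over every measurable set, in particular where \<open>f\<close> is
  positive and where it is negative.\<close>

lemma orthogonal_imp_AE_zero:
  assumes f: "L2 f" and orth: "\<And>v. v \<in> W0 \<Longrightarrow> (\<integral>x. f x * v x \<partial>\<zeta>) = 0"
  shows "AE x in \<zeta>. f x = 0"
proof -
  have fm: "f \<in> borel_measurable \<zeta>" using f by (simp add: L2_def)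
  have int: "set_integrable \<zeta> (A \<inter> K) f" if "A \<in> sets borel" for A
    unfolding set_integrable_def
    by (intro integrable_mult_indicator L2_integrable f) (use that sets_measure_iff in blast)
  have zero: "(LINT x:(A \<inter> K)|\<zeta>. f x) = 0" if "A \<in> sigma_sets UNIV (Collect closed)" for A
  proof -
    have "Int_stable (Collect closed :: (real^2) set set)" "Collect closed \<subseteq> Pow (UNIV :: (real^2) set)"
      by (auto simp: Int_stable_def)
    from this that show ?thesis
    proof (induction A rule: sigma_sets_induct_disjoint)
      case (basic A)
      have "(LINT x:(A \<inter> K)|\<zeta>. f x) = (\<integral>x. f x * indicator A x \<partial>\<zeta>)"
        unfolding set_lebesgue_integral_def
        by (intro Bochner_Integration.integral_cong) (auto simp: space_measure indicator_def)
      then show ?case using closed_integral_zero[OF f orth] basic by simp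
    next
      case (compl A)
      have A: "A \<in> sets borel" using compl(1) by (simp add: borel_eq_closed)
      have "(LINT x:(UNIV \<inter> K)|\<zeta>. f x) = (\<integral>x. f x * indicator UNIV x \<partial>\<zeta>)"
        unfolding set_lebesgue_integral_def
        by (intro Bochner_Integration.integral_cong) (auto simp: space_measure indicator_def)
      then have "(LINT x:((A \<inter> K) \<union> ((UNIV - A) \<inter> K))|\<zeta>. f x) = 0"
        using closed_integral_zero[OF f orth, of UNIV] by (simp flip: Int_Un_distrib2)
      moreover have "(LINT x:((A \<inter> K) \<union> ((UNIV - A) \<inter> K))|\<zeta>. f x)
          = (LINT x:(A \<inter> K)|\<zeta>. f x) + (LINT x:((UNIV - A) \<inter> K)|\<zeta>. f x)"
        using A by (intro set_integral_Un int) auto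
      ultimately show ?case using compl(2) by simp
    next
      case (union A)
      have A: "A i \<in> sets borel" for i using union(2) by (auto simp: borel_eq_closed)
      have "(LINT x:(\<Union>i. A i \<inter> K)|\<zeta>. f x) = (\<Sum>i. LINT x:(A i \<inter> K)|\<zeta>. f x)"
      proof (rule lebesgue_integral_countable_add)
        show "A i \<inter> K \<in> sets \<zeta>" for i using A sets_measure_iff by blast
        show "A i \<inter> K \<inter> (A j \<inter> K) = {}" if "i \<noteq> j" for i j
          using union(1) that unfolding disjoint_family_on_def by blast
        show "set_integrable \<zeta> (\<Union>i. A i \<inter> K) f"
          using int[of "\<Union>i. A i"] A by (auto simp: Int_UN_distrib2)
      qed
      then show ?case using union(3) by simp
    qed (simp add: set_lebesgue_integral_def)
  qed
  have set_zero: "(LINT x:B|\<zeta>. f x) = 0" if "B \<in> sets \<zeta>" for B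
    using that zero unfolding sets_measure_iff by (auto simp: borel_eq_closed)
  have "AE x in \<zeta>. indicator {x \<in> space \<zeta>. f x > 0} x * f x = 0"
  proof (subst integral_nonneg_eq_0_iff_AE[symmetric])
    show "integrable \<zeta> (\<lambda>x. indicator {x \<in> space \<zeta>. f x > 0} x * f x)"
      using integrable_mult_indicator[OF _ L2_integrable[OF f], of "{x \<in> space \<zeta>. f x > 0}"] fm by simp
    show "AE x in \<zeta>. 0 \<le> indicator {x \<in> space \<zeta>. f x > 0} x * f x"
      by (auto simp: indicator_def)
    show "(\<integral>x. indicator {x \<in> space \<zeta>. f x > 0} x * f x \<partial>\<zeta>) = 0"
      using set_zero[of "{x \<in> space \<zeta>. f x > 0}"] fm by (simp add: set_lebesgue_integral_def)
  qed
  moreover have "AE x in \<zeta>. indicator {x \<in> space \<zeta>. f x < 0} x * - f x = 0"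
  proof (subst integral_nonneg_eq_0_iff_AE[symmetric])
    show "integrable \<zeta> (\<lambda>x. indicator {x \<in> space \<zeta>. f x < 0} x * - f x)"
      using integrable_mult_indicator[OF _ L2_integrable[OF f], of "{x \<in> space \<zeta>. f x < 0}"] fm by simp
    show "AE x in \<zeta>. 0 \<le> indicator {x \<in> space \<zeta>. f x < 0} x * - f x"
      by (auto simp: indicator_def)
    show "(\<integral>x. indicator {x \<in> space \<zeta>. f x < 0} x * - f x \<partial>\<zeta>) = 0"
      using set_zero[of "{x \<in> space \<zeta>. f x < 0}"] fm by (simp add: set_lebesgue_integral_def)
  qed
  ultimately show ?thesis
  proof (rule AE_mp[OF _ AE_mp[OF _ AE_I2]], intro impI)
    fix x assume "x \<in> space \<zeta>" "indicator {x \<in> space \<zeta>. f x < 0} x * - f x = 0"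
      "indicator {x \<in> space \<zeta>. f x > 0} x * f x = 0"
    then show "f x = 0" by (cases "f x" "0 :: real" rule: linorder_cases) auto
  qed
qed

text \<open>A nonzero value at \<open>x\<close> persists on a small cell containing
  \<open>x\<close>, and that cell has positive mass.\<close>

lemma continuous_integral_square_zero:
  fixes f :: "real^2 \<Rightarrow> real"
  assumes f: "continuous_on K f" and z: "(\<integral>x. (f x)\<^sup>2 \<partial>\<zeta>) = 0" and x: "x \<in> K"
  shows "f x = 0"
proof (rule ccontr)
  assume nz: "f x \<noteq> 0"
  have "AE y in \<zeta>. (f y)\<^sup>2 = 0"
    using L2_continuous[OF f] z by (subst (asm) integral_nonneg_eq_0_iff_AE) (auto simp: L2_def)
  then have ae: "AE y in \<zeta>. f y = 0" by simp
  obtain d where d: "d > 0" "\<And>y. y \<in> K \<Longrightarrow> dist y x < d \<Longrightarrow> dist (f y) (f x) < \<bar>f x\<bar>"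
    using f x nz unfolding continuous_on_iff by (metis zero_less_abs_iff)
  obtain n where n: "diameter K / 2 ^ n < d"
    using eventually_happens[OF cells_small[OF d(1)]] by auto
  obtain w where w: "w \<in> sg_words n" "x \<in> sg_word_map q w ` K"
    using SG_cell_cover[OF x] by blast
  let ?C = "sg_word_map q w ` K"
  have nzC: "f y \<noteq> 0" if "y \<in> ?C" for y
  proof -
    have "y \<in> K" using that sg_word_map_SG_subset[OF w(1)] by blast
    moreover have "dist y x < d"
      using cell_vertex_near[OF w that] n by (simp add: dist_commute[of y x])
    ultimately have "dist (f y) (f x) < \<bar>f x\<bar>" by (rule d(2))
    then show ?thesis by (auto simp: dist_real_def)
  qed
  have "compact ?C" by (intro compact_continuous_image continuous_on_sg_word_map compact_SG)
  then have "?C \<in> sets \<zeta>"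
    unfolding sets_measure_iff using sg_word_map_SG_subset[OF w(1), of q]
    by (intro bexI[of _ ?C]) (auto intro: borel_compact)
  moreover have "AE y in \<zeta>. y \<notin> ?C" using ae by eventually_elim (use nzC in blast)
  ultimately have "emeasure \<zeta> ?C = 0"
    using AE_iff_null_sets[of ?C \<zeta>] by auto
  moreover have "emeasure \<zeta> ?C > 0"
    using measure w(1) unfolding finite_positive_continuous_measure_def by blast
  ultimately show False by simp
qed

end

section \<open>Splines\<close>

lemma function_space_sum:
  fixes S :: "('a \<Rightarrow> real) set"
  assumes zero: "(\<lambda>x. 0) \<in> S" and add: "\<And>u v. u \<in> S \<Longrightarrow> v \<in> S \<Longrightarrow> (\<lambda>x. u x + v x) \<in> S"
    and scale: "\<And>c u. u \<in> S \<Longrightarrow> (\<lambda>x. c * u x) \<in> S"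
  shows "finite I \<Longrightarrow> (\<And>i. i \<in> I \<Longrightarrow> e i \<in> S) \<Longrightarrow> (\<lambda>x. \<Sum>i\<in>I. c i * e i x) \<in> S"
proof (induction I rule: finite_induct)
  case (insert j I)
  then show ?case using add[OF scale[of "e j" "c j"], of "\<lambda>x. \<Sum>i\<in>I. c i * e i x"] by simp
qed (simp add: zero)

text \<open>Adding a point \<open>k\<close>, it suffices to find an element of \<open>S\<close> that
  vanishes on \<open>E\<close> but not at \<open>k\<close>; a multiple of it corrects the value at
  \<open>k\<close>.\<close>

lemma function_space_interpolation:
  fixes S :: "('a \<Rightarrow> real) set"
  assumes zero: "(\<lambda>x. 0) \<in> S" and add: "\<And>u v. u \<in> S \<Longrightarrow> v \<in> S \<Longrightarrow> (\<lambda>x. u x + v x) \<in> S"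
    and scale: "\<And>c u. u \<in> S \<Longrightarrow> (\<lambda>x. c * u x) \<in> S"
  shows "finite E \<Longrightarrow>
    (\<And>\<gamma> p. (\<And>u. u \<in> S \<Longrightarrow> (\<Sum>p\<in>E. \<gamma> p * u p) = 0) \<Longrightarrow> p \<in> E \<Longrightarrow> \<gamma> p = (0::real)) \<Longrightarrow>
    \<exists>u\<in>S. \<forall>p\<in>E. u p = a p"
proof (induction E arbitrary: a rule: finite_induct)
  case (insert k E)
  have IH: "\<exists>u\<in>S. \<forall>p\<in>E. u p = b p" for b
  proof (rule insert.IH)
    fix \<gamma> p assume \<gamma>: "\<And>u. u \<in> S \<Longrightarrow> (\<Sum>p\<in>E. \<gamma> p * u p) = 0" and p: "p \<in> E"
    have "(\<Sum>p\<in>insert k E. (\<gamma>(k := 0)) p * u p) = 0" if "u \<in> S" for u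
    proof -
      have "(\<Sum>p\<in>E. (\<gamma>(k := 0)) p * u p) = (\<Sum>p\<in>E. \<gamma> p * u p)"
        using insert.hyps(2) by (intro sum.cong) auto
      then show ?thesis using insert.hyps \<gamma>[OF that] by simp
    qed
    from insert.prems[of "\<gamma>(k := 0)" p, OF this insertI2[OF p]]
    show "\<gamma> p = 0" using p insert.hyps(2) by (auto split: if_splits)
  qed
  have "\<forall>i. \<exists>u. u \<in> S \<and> (\<forall>p\<in>E. u p = (if p = i then 1 else 0))"
    using IH[of "\<lambda>p. if p = _ then 1 else 0"] by blast
  then obtain e where e: "\<And>i. e i \<in> S" "\<And>i p. p \<in> E \<Longrightarrow> e i p = (if p = i then 1 else 0)"
    by metis
  have "\<exists>v\<in>S. (\<forall>p\<in>E. v p = 0) \<and> v k \<noteq> 0"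
  proof (rule ccontr)
    assume no: "\<not> ?thesis"
    \<comment> \<open>Were there no such element, every \<open>u\<close> in \<open>S\<close> would
      satisfy \<open>u k = (\<Sum>p\<in>E. u p * e p k)\<close>. This relation is an annihilator
      with coefficient 1 at \<open>k\<close>.\<close>
    define \<gamma> where "\<gamma> p = (if p = k then 1 else - e p k)" for p
    have "(\<Sum>p\<in>insert k E. \<gamma> p * u p) = 0" if u: "u \<in> S" for u
    proof -
      define v where "v x = u x + (\<Sum>i\<in>E. - u i * e i x)" for x
      have "v \<in> S"
        unfolding v_def[abs_def]
        by (intro add u function_space_sum[OF zero add scale] insert.hyps e)
      moreover have "v p = 0" if p: "p \<in> E" for p
      proof -
        have "(\<Sum>i\<in>E. - u i * e i p) = (\<Sum>i\<in>E. if i = p then - u i else 0)"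
          using e(2)[OF p] by (intro sum.cong) auto
        then show ?thesis using p insert.hyps(1) by (simp add: v_def)
      qed
      ultimately have "v k = 0" using no by blast
      moreover have "(\<Sum>p\<in>E. \<gamma> p * u p) = (\<Sum>i\<in>E. - u i * e i k)"
        using insert.hyps(2) by (intro sum.cong) (auto simp: \<gamma>_def)
      ultimately show ?thesis using insert.hyps by (simp add: v_def \<gamma>_def)
    qed
    from insert.prems[OF this, of k] show False by (simp add: \<gamma>_def)
  qed
  then obtain v where v: "v \<in> S" "\<And>p. p \<in> E \<Longrightarrow> v p = 0" "v k \<noteq> 0" by blast
  obtain w where w: "w \<in> S" "\<And>p. p \<in> E \<Longrightarrow> w p = a p" using IH by blast
  show ?case
  proof (rule bexI)
    show "(\<lambda>x. w x + (a k - w k) / v k * v x) \<in> S" by (intro add scale v w)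
    show "\<forall>p\<in>insert k E. w p + (a k - w k) / v k * v p = a p" using v w by auto
  qed
qed (use zero in blast)

context gasket_measure begin

lemma integral_K_cong: "(\<And>x. x \<in> K \<Longrightarrow> f x = g x) \<Longrightarrow> (\<integral>x. f x \<partial>\<zeta>) = (\<integral>x. g x \<partial>\<zeta>)"
  by (intro Bochner_Integration.integral_cong) (auto simp: space_measure)

lemma W_L2: "u \<in> W \<Longrightarrow> L2 u"
  by (rule L2_continuous[OF W_continuous])

text \<open>Integration against \<open>f\<close> is bounded on \<open>W0\<close> in the energy norm:
  the constant is the product of a bound for \<open>f\<close>, the 5 of the sup bound and the total
  mass.\<close>

lemma Green_operator:
  assumes f: "continuous_on K f"
  obtains u where "u \<in> W0" "\<And>v. v \<in> W0 \<Longrightarrow> energy_form q u v = - (\<integral>x. f x * v x \<partial>\<zeta>)"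
proof -
  obtain C where C: "C > 0" "\<And>x. x \<in> K \<Longrightarrow> \<bar>f x\<bar> \<le> C" using continuous_bounded[OF f] by blast
  have int: "integrable \<zeta> (\<lambda>x. f x * v x)" if "v \<in> W0" for v
    by (rule L2_mult[OF L2_continuous[OF f] W_L2[OF W0_W[OF that]]])
  show thesis
  proof (rule W0_Riesz[of "\<lambda>v. - (\<integral>x. f x * v x \<partial>\<zeta>)" "C * 5 * Sigma_Algebra.measure \<zeta> (space \<zeta>)"])
    show "- (\<integral>x. f x * (u x + v x) \<partial>\<zeta>) = - (\<integral>x. f x * u x \<partial>\<zeta>) + - (\<integral>x. f x * v x \<partial>\<zeta>)"
      if "u \<in> W0" "v \<in> W0" for u v
      using int[OF that(1)] int[OF that(2)] by (simp add: distrib_left)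
    show "- (\<integral>x. f x * (c * u x) \<partial>\<zeta>) = c * - (\<integral>x. f x * u x \<partial>\<zeta>)" for c u
      by (simp add: mult.left_commute)
    show "\<bar>- (\<integral>x. f x * v x \<partial>\<zeta>)\<bar> \<le> C * 5 * Sigma_Algebra.measure \<zeta> (space \<zeta>) * sqrt (real_energy q v)"
      if v: "v \<in> W0" for v
    proof -
      have "\<bar>\<integral>x. f x * v x \<partial>\<zeta>\<bar> \<le> (\<integral>x. \<bar>f x * v x\<bar> \<partial>\<zeta>)" by (rule integral_abs_bound)
      also have "\<dots> \<le> (\<integral>x. C * (5 * sqrt (real_energy q v)) \<partial>\<zeta>)"
      proof (rule integral_mono)
        show "integrable \<zeta> (\<lambda>x. \<bar>f x * v x\<bar>)" using int[OF v] by simp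
        show "\<bar>f x * v x\<bar> \<le> C * (5 * sqrt (real_energy q v))" if "x \<in> space \<zeta>" for x
          unfolding abs_mult using that C W0_sup_bound[OF v] by (intro mult_mono) (auto simp: space_measure)
      qed simp
      finally show ?thesis by (simp add: mult_ac)
    qed
  qed (rule that)
qed

lemma has_laplacian_iff:
  "has_laplacian q \<zeta> u f \<longleftrightarrow> L2 f \<and> (\<forall>v\<in>W0. energy_form q u v = - (\<integral>x. f x * v x \<partial>\<zeta>))"
proof
  assume h: "has_laplacian q \<zeta> u f"
  have "energy_form q u v = - (\<integral>x. f x * v x \<partial>\<zeta>)" if v: "v \<in> W0" for v
  proof -
    have "restrict v K \<in> dom_energy q"
      using W0_W[OF v] restrict_W_iff[of v] by (auto simp: dom_energy_iff W_def)
    moreover have "\<forall>x\<in>sg_V q 0. restrict v K x = 0"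
      using v vertex_in_SG by (auto simp: W0_def)
    ultimately have "energy_form q u (restrict v K) = - (\<integral>x. f x * restrict v K x \<partial>\<zeta>)"
      using h unfolding has_laplacian_def by blast
    moreover have "(\<integral>x. f x * restrict v K x \<partial>\<zeta>) = (\<integral>x. f x * v x \<partial>\<zeta>)"
      by (rule integral_K_cong) simp
    ultimately show ?thesis using energy_form_cong[of u u "restrict v K" v] by simp
  qed
  then show "L2 f \<and> (\<forall>v\<in>W0. energy_form q u v = - (\<integral>x. f x * v x \<partial>\<zeta>))"
    using h by (simp add: has_laplacian_def L2_def)
next
  assume h: "L2 f \<and> (\<forall>v\<in>W0. energy_form q u v = - (\<integral>x. f x * v x \<partial>\<zeta>))"
  have "v \<in> W0" if "v \<in> dom_energy q" "\<forall>x\<in>sg_V q 0. v x = 0" for v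
    using that by (auto simp: W0_def W_def dom_energy_iff)
  with h show "has_laplacian q \<zeta> u f" by (auto simp: has_laplacian_def L2_def)
qed

lemma has_laplacian_unique:
  assumes f: "has_laplacian q \<zeta> u f" and g: "has_laplacian q \<zeta> u g"
  shows "AE x in \<zeta>. f x = g x"
proof -
  have L: "L2 f" "L2 g" using f g by (simp_all add: has_laplacian_iff)
  have "AE x in \<zeta>. f x - g x = 0"
  proof (rule orthogonal_imp_AE_zero[OF L2_diff[OF L]])
    fix v assume v: "v \<in> W0"
    have "(\<integral>x. f x * v x \<partial>\<zeta>) = (\<integral>x. g x * v x \<partial>\<zeta>)"
      using f g v unfolding has_laplacian_iff by (metis neg_equal_iff_equal)
    then show "(\<integral>x. (f x - g x) * v x \<partial>\<zeta>) = 0"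
      using L2_mult[OF L(1) W_L2[OF W0_W[OF v]]] L2_mult[OF L(2) W_L2[OF W0_W[OF v]]]
      by (simp add: left_diff_distrib)
  qed
  then show ?thesis by simp
qed

text \<open>\<open>laplacian\<close> is an arbitrary choice; almost everywhere uniqueness lets any
  representative be used instead.\<close>

lemma spline_functional_eq:
  assumes f: "has_laplacian q \<zeta> u f" shows "spline_functional q \<zeta> u = (\<integral>x. (f x)\<^sup>2 \<partial>\<zeta>)"
proof -
  have l: "has_laplacian q \<zeta> u (laplacian q \<zeta> u)"
    unfolding laplacian_def using someI[of "has_laplacian q \<zeta> u" f] f by blast
  have [measurable]: "f \<in> borel_measurable \<zeta>" "laplacian q \<zeta> u \<in> borel_measurable \<zeta>"
    using f l by (simp_all add: has_laplacian_def)
  show ?thesis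
    unfolding spline_functional_def
  proof (rule integral_cong_AE)
    show "AE x in \<zeta>. (laplacian q \<zeta> u x)\<^sup>2 = (f x)\<^sup>2"
      using has_laplacian_unique[OF l f] by eventually_elim simp
  qed measurable
qed

text \<open>The Green function with pole \<open>p\<close> and zero boundary values on
  \<open>V 0\<close>.\<close>

definition representer :: "real^2 \<Rightarrow> real^2 \<Rightarrow> real" where
  "representer p = (SOME g. g \<in> W0 \<and> (\<forall>v\<in>W0. energy_form q g v = v p))"

lemma representer:
  assumes "p \<in> K"
  shows representer_W0: "representer p \<in> W0"
    and energy_form_representer: "v \<in> W0 \<Longrightarrow> energy_form q (representer p) v = v p"
proof -
  have "\<exists>g. g \<in> W0 \<and> (\<forall>v\<in>W0. energy_form q g v = v p)"
    using point_evaluation_representer[OF assms] by metis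
  then have "representer p \<in> W0 \<and> (\<forall>v\<in>W0. energy_form q (representer p) v = v p)"
    unfolding representer_def by (rule someI_ex)
  then show "representer p \<in> W0" "v \<in> W0 \<Longrightarrow> energy_form q (representer p) v = v p" by auto
qed

definition combination :: "(real^2) set \<Rightarrow> (real^2 \<Rightarrow> real) \<Rightarrow> real^2 \<Rightarrow> real" where
  "combination E \<beta> x = (\<Sum>p\<in>E. \<beta> p * representer p x)"

text \<open>Membership is in \<open>W\<close> rather than \<open>dom_energy\<close>, so that splines
  form a linear space under pointwise operations.\<close>

definition spline :: "(real^2) set \<Rightarrow> (real^2 \<Rightarrow> real) \<Rightarrow> (real^2 \<Rightarrow> real) \<Rightarrow> bool" where
  "spline E \<beta> u \<longleftrightarrow> u \<in> W \<and> (\<forall>j<3. (\<Sum>p\<in>E. \<beta> p * harmonic_basis q j p) = 0) \<and>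
    (\<forall>v\<in>W0. energy_form q u v = - (\<integral>x. combination E \<beta> x * v x \<partial>\<zeta>))"

lemma combination_W0: "finite E \<Longrightarrow> E \<subseteq> K \<Longrightarrow> combination E \<beta> \<in> W0"
  unfolding combination_def[abs_def] by (intro W0_sum representer_W0) auto

lemma energy_form_combination:
  assumes "finite E" "E \<subseteq> K" "v \<in> W0"
  shows "energy_form q (combination E \<beta>) v = (\<Sum>p\<in>E. \<beta> p * v p)"
  unfolding combination_def[abs_def] using assms
  by (subst energy_form_sum_left)
    (auto intro!: sum.cong W0_bounded representer_W0 simp: energy_form_representer subset_eq)

text \<open>Pair with a \<open>v\<close> that is 1 at \<open>p\<close> and 0 at the other points of
  \<open>V m\<close>; as \<open>p\<close> is not in \<open>V 0\<close>, this \<open>v\<close> lies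
  in \<open>W0\<close>.\<close>

lemma combination_eq_zero_imp:
  assumes E: "finite E" "E \<subseteq> V m" and z: "\<And>x. x \<in> K \<Longrightarrow> combination E \<gamma> x = 0"
    and p: "p \<in> E" "p \<notin> V 0"
  shows "\<gamma> p = 0"
proof -
  have EK: "E \<subseteq> K" using E(2) sg_V_subset_SG by blast
  obtain v where v: "continuous_on K v" "energy_bounded q v" "\<forall>x\<in>V m. v x = (if x = p then 1 else 0)"
    using extension[of m "\<lambda>x. if x = p then 1 else 0"] by blast
  have "v (q i) = 0" if "i < 3" for i
    using v(3) vertex_in_sg_V[OF that, of q m] p(2) that by (auto dest: bspec)
  then have v0: "v \<in> W0" using v by (simp add: W0_def W_def)
  have "(\<Sum>r\<in>E. \<gamma> r * v r) = energy_form q (combination E \<gamma>) v"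
    by (rule energy_form_combination[OF E(1) EK v0, symmetric])
  also have "\<dots> = energy_form q (\<lambda>x. 0) v" by (rule energy_form_cong) (simp_all add: z)
  also have "\<dots> = 0" by (rule energy_form_zero_left[OF W0_bounded[OF v0]])
  finally have "(\<Sum>r\<in>E. if r = p then \<gamma> r else 0) = 0"
    using v(3) E(2) by (subst sum.cong[OF refl, of E _ "\<lambda>r. \<gamma> r * v r"]) auto
  then show ?thesis using p(1) E(1) by simp
qed

lemma spline_nondegenerate:
  assumes E: "finite E" "E \<subseteq> V m"
    and ann: "\<And>\<beta> u. spline E \<beta> u \<Longrightarrow> (\<Sum>p\<in>E. \<gamma> p * u p) = 0" and p: "p \<in> E"
  shows "\<gamma> p = 0"
proof -
  have EK: "E \<subseteq> K" using E(2) sg_V_subset_SG by blast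
  have harm: "(\<Sum>p\<in>E. \<gamma> p * harmonic_basis q j p) = 0" for j
  proof (rule ann)
    \<comment> \<open>Harmonic functions have Laplacian zero, so the annihilator is forced to
      satisfy the side condition itself.\<close>
    show "spline E (\<lambda>p. 0) (harmonic_basis q j)"
      by (simp add: spline_def harmonic_basis_W harmonic_basis_orthogonal combination_def)
  qed
  let ?f = "combination E \<gamma>"
  have f: "?f \<in> W0" by (rule combination_W0[OF E(1) EK])
  have fc: "continuous_on K ?f" by (rule W_continuous[OF W0_W[OF f]])
  obtain u where u: "u \<in> W0" "\<And>v. v \<in> W0 \<Longrightarrow> energy_form q u v = - (\<integral>x. ?f x * v x \<partial>\<zeta>)"
    using Green_operator[OF fc] by blast
  have "spline E \<gamma> u" using u harm by (simp add: spline_def W0_W)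
  then have "(\<Sum>p\<in>E. \<gamma> p * u p) = 0" by (rule ann)
  then have "energy_form q u ?f = 0"
    using energy_form_combination[OF E(1) EK u(1)] by (simp add: energy_form_commute)
  then have "(\<integral>x. (?f x)\<^sup>2 \<partial>\<zeta>) = 0" using u(2)[OF f] by (simp add: power2_eq_square)
  then have z: "x \<in> K \<Longrightarrow> ?f x = 0" for x by (rule continuous_integral_square_zero[OF fc])
  have interior: "\<gamma> r = 0" if "r \<in> E" "r \<notin> V 0" for r
    by (rule combination_eq_zero_imp[OF E z that])
  show ?thesis
  proof (cases "p \<in> V 0")
    case True
    then obtain j where j: "j < 3" "p = q j" by auto
    \<comment> \<open>Off \<open>V 0\<close> the coefficients already vanish, and on
      \<open>V 0\<close> the harmonic basis is a Kronecker delta, so the side condition isolates the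
      coefficient at \<open>q j\<close>.\<close>
    have "\<gamma> r * harmonic_basis q j r = (if r = p then \<gamma> r else 0)" if r: "r \<in> E" for r
    proof (cases "r \<in> V 0")
      case True
      then obtain i where i: "i < 3" "r = q i" by auto
      then show ?thesis using j by (auto simp: harmonic_basis_vertex vertices_eq_iff)
    next
      case False
      then show ?thesis using interior[OF r] by auto
    qed
    then have "(\<Sum>r\<in>E. if r = p then \<gamma> r else 0) = (\<Sum>r\<in>E. \<gamma> r * harmonic_basis q j r)"
      by simp
    then show ?thesis using harm[of j] p E(1) by simp
  qed (use interior p in blast)
qed

lemma spline_interpolation:
  assumes E: "finite E" "E \<subseteq> V m"
  obtains \<beta> u where "spline E \<beta> u" "\<And>p. p \<in> E \<Longrightarrow> u p = \<alpha> p"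
proof -
  have EK: "E \<subseteq> K" using E(2) sg_V_subset_SG by blast
  have L: "L2 (combination E \<beta>)" for \<beta> by (rule W_L2[OF W0_W[OF combination_W0[OF E(1) EK]]])
  define S where "S = {u. \<exists>\<beta>. spline E \<beta> u}"
  have "\<exists>u\<in>S. \<forall>p\<in>E. u p = \<alpha> p"
  proof (rule function_space_interpolation)
    show "(\<lambda>x. 0) \<in> S"
      unfolding S_def
      by (auto simp: spline_def W0_W zero_in_W0 energy_form_zero_left W0_bounded combination_def
          intro!: exI[of _ "\<lambda>p. 0"])
    show "(\<lambda>x. u x + v x) \<in> S" if uv: "u \<in> S" "v \<in> S" for u v
    proof -
      obtain \<beta> \<gamma> where \<beta>: "spline E \<beta> u" and \<gamma>: "spline E \<gamma> v" using uv unfolding S_def by blast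
      have c: "combination E (\<lambda>p. \<beta> p + \<gamma> p) x = combination E \<beta> x + combination E \<gamma> x" for x
        by (simp add: combination_def distrib_right sum.distrib)
      have "spline E (\<lambda>p. \<beta> p + \<gamma> p) (\<lambda>x. u x + v x)"
        unfolding spline_def
      proof (intro conjI ballI allI impI)
        show "(\<lambda>x. u x + v x) \<in> W" using \<beta> \<gamma> by (simp add: spline_def W_add)
        show "(\<Sum>p\<in>E. (\<beta> p + \<gamma> p) * harmonic_basis q j p) = 0" if "j < 3" for j
          using \<beta> \<gamma> that by (simp add: spline_def distrib_right sum.distrib)
        fix w assume w: "w \<in> W0"
        have "energy_form q (\<lambda>x. u x + v x) w = energy_form q u w + energy_form q v w"
          using \<beta> \<gamma> w by (intro energy_form_add_left) (auto simp: spline_def W_bounded W0_bounded)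
        then show "energy_form q (\<lambda>x. u x + v x) w = - (\<integral>x. combination E (\<lambda>p. \<beta> p + \<gamma> p) x * w x \<partial>\<zeta>)"
          using \<beta> \<gamma> w L2_mult[OF L W_L2[OF W0_W[OF w]]]
          unfolding c by (simp add: spline_def distrib_right)
      qed
      then show ?thesis unfolding S_def by blast
    qed
    show "(\<lambda>x. k * u x) \<in> S" if u: "u \<in> S" for k u
    proof -
      obtain \<beta> where \<beta>: "spline E \<beta> u" using u unfolding S_def by blast
      have c: "combination E (\<lambda>p. k * \<beta> p) x = k * combination E \<beta> x" for x
        by (simp add: combination_def sum_distrib_left mult.assoc)
      have "spline E (\<lambda>p. k * \<beta> p) (\<lambda>x. k * u x)"
        unfolding spline_def
      proof (intro conjI ballI allI impI)
        show "(\<lambda>x. k * u x) \<in> W" using \<beta> by (simp add: spline_def W_scale)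
        show "(\<Sum>p\<in>E. (k * \<beta> p) * harmonic_basis q j p) = 0" if "j < 3" for j
          using \<beta> that by (simp add: spline_def mult.assoc flip: sum_distrib_left)
        fix w assume w: "w \<in> W0"
        have "energy_form q (\<lambda>x. k * u x) w = k * energy_form q u w"
          using \<beta> w by (intro energy_form_scale_left) (auto simp: spline_def W_bounded W0_bounded)
        then show "energy_form q (\<lambda>x. k * u x) w = - (\<integral>x. combination E (\<lambda>p. k * \<beta> p) x * w x \<partial>\<zeta>)"
          using \<beta> w unfolding c by (simp add: spline_def mult.assoc)
      qed
      then show ?thesis unfolding S_def by blast
    qed
    show "finite E" by (rule E)
    show "\<gamma> p = 0" if "\<And>u. u \<in> S \<Longrightarrow> (\<Sum>p\<in>E. \<gamma> p * u p) = 0" "p \<in> E" for \<gamma> p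
      by (rule spline_nondegenerate[OF E _ that(2)]) (use that(1) S_def in blast)
  qed
  then show thesis using that unfolding S_def by blast
qed

text \<open>The representers turn the integral into values of \<open>w\<close> minus its harmonic part; the former
  vanish on \<open>E\<close> and the latter are annihilated by the side condition on \<open>\<beta>\<close>.\<close>

lemma spline_orthogonal:
  assumes E: "finite E" "E \<subseteq> K" and s: "spline E \<beta> u"
    and w: "w \<in> W" "\<And>p. p \<in> E \<Longrightarrow> w p = 0"
    and f: "L2 f" "\<And>v. v \<in> W0 \<Longrightarrow> energy_form q w v = - (\<integral>x. f x * v x \<partial>\<zeta>)"
  shows "(\<integral>x. f x * combination E \<beta> x \<partial>\<zeta>) = 0"
proof -
  let ?w0 = "\<lambda>x. w x - harmonic_part w x"
  let ?g = "combination E \<beta>"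
  have w0: "?w0 \<in> W0" by (rule diff_harmonic_part_W0[OF w(1)])
  have g: "?g \<in> W0" by (rule combination_W0[OF E])
  have "(\<integral>x. f x * ?g x \<partial>\<zeta>) = - energy_form q w ?g" using f(2)[OF g] by simp
  also have "energy_form q w ?g = energy_form q ?w0 ?g"
    using energy_form_diff_left[OF W_bounded[OF w(1)] W_bounded[OF harmonic_part_W] W0_bounded[OF g]]
    by (simp add: harmonic_part_orthogonal[OF g])
  also have "\<dots> = (\<Sum>p\<in>E. \<beta> p * ?w0 p)"
    using energy_form_combination[OF E w0] by (simp add: energy_form_commute)
  also have "\<dots> = - (\<Sum>p\<in>E. \<Sum>j<3. w (q j) * (\<beta> p * harmonic_basis q j p))"
    unfolding sum_negf[symmetric]
    by (intro sum.cong refl) (simp add: w(2) harmonic_part_def sum_distrib_left sum_negf mult_ac)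
  also have "\<dots> = - (\<Sum>j<3. w (q j) * (\<Sum>p\<in>E. \<beta> p * harmonic_basis q j p))"
    unfolding sum_distrib_left by (subst sum.swap) (rule refl)
  also have "\<dots> = 0" using s by (simp add: spline_def)
  finally show ?thesis by simp
qed

lemma unique_minimizer:
  assumes E: "finite E" "E \<subseteq> V m"
    and uni: "\<And>c j. (\<And>p. p \<in> E \<Longrightarrow> (\<Sum>j<3. c j * harmonic_basis q j p) = 0) \<Longrightarrow> j < 3 \<Longrightarrow> c j = 0"
    and Y: "Y = {u \<in> dom_laplacian q \<zeta>. \<forall>p\<in>E. u p = \<alpha> p}"
  shows "\<exists>!u. u \<in> Y \<and> (\<forall>v\<in>Y. spline_functional q \<zeta> u \<le> spline_functional q \<zeta> v)"
proof -
  have EK: "E \<subseteq> K" using E(2) sg_V_subset_SG by blast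
  obtain \<beta> u0 where u0: "spline E \<beta> u0" "\<And>p. p \<in> E \<Longrightarrow> u0 p = \<alpha> p"
    using spline_interpolation[OF E] by blast
  \<comment> \<open>Elements of \<open>Y\<close> must be \<open>extensional\<close>; splines need
    not be.\<close>
  define u where "u = restrict u0 K"
  define f where "f = combination E \<beta>"
  have fL: "L2 f" unfolding f_def by (rule W_L2[OF W0_W[OF combination_W0[OF E(1) EK]]])
  have uW: "u \<in> W" using u0(1) by (simp add: u_def restrict_W_iff spline_def)
  have uf: "energy_form q u v = - (\<integral>x. f x * v x \<partial>\<zeta>)" if "v \<in> W0" for v
    using u0(1) that energy_form_cong[of u u0 v v] by (simp add: spline_def u_def f_def)
  have ul: "has_laplacian q \<zeta> u f" by (simp add: has_laplacian_iff fL uf)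
  have uY: "u \<in> Y"
    using uW ul u0(2) EK unfolding Y dom_laplacian_def dom_energy_iff W_def
    by (auto simp: u_def subset_eq)
  \<comment> \<open>Here \<open>g\<close> is the difference of the two Laplacians. It is orthogonal
    to \<open>f\<close> because \<open>v - u\<close> vanishes on \<open>E\<close>, which leaves a
    Pythagorean identity.\<close>
  have key: "\<exists>g. L2 g \<and> (\<forall>\<phi>\<in>W0. energy_form q (\<lambda>x. v x - u x) \<phi> = - (\<integral>x. g x * \<phi> x \<partial>\<zeta>)) \<and>
      spline_functional q \<zeta> v = spline_functional q \<zeta> u + (\<integral>x. (g x)\<^sup>2 \<partial>\<zeta>)" if v: "v \<in> Y" for v
  proof -
    obtain h where h: "has_laplacian q \<zeta> v h" and vW: "v \<in> W"
      using v unfolding Y dom_laplacian_def dom_energy_iff W_def by blast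
    have hL: "L2 h" using h by (simp add: has_laplacian_iff)
    let ?g = "\<lambda>x. h x - f x"
    have gL: "L2 ?g" by (rule L2_diff[OF hL fL])
    have form: "energy_form q (\<lambda>x. v x - u x) \<phi> = - (\<integral>x. ?g x * \<phi> x \<partial>\<zeta>)" if \<phi>: "\<phi> \<in> W0" for \<phi>
    proof -
      have "energy_form q (\<lambda>x. v x - u x) \<phi> = energy_form q v \<phi> - energy_form q u \<phi>"
        by (intro energy_form_diff_left W_bounded vW uW W0_W \<phi>)
      then show ?thesis
        using h \<phi> L2_mult[OF hL W_L2[OF W0_W[OF \<phi>]]] L2_mult[OF fL W_L2[OF W0_W[OF \<phi>]]]
        by (simp add: has_laplacian_iff uf left_diff_distrib)
    qed
    have "(\<integral>x. ?g x * f x \<partial>\<zeta>) = 0"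
      unfolding f_def
    proof (rule spline_orthogonal[OF E(1) EK u0(1) W_diff[OF vW uW]])
      show "v p - u p = 0" if "p \<in> E" for p using v uY that by (simp add: Y)
    qed (use gL form in \<open>auto simp: f_def\<close>)
    then have "(\<integral>x. (?g x)\<^sup>2 + 2 * (?g x * f x) + (f x)\<^sup>2 \<partial>\<zeta>) = (\<integral>x. (?g x)\<^sup>2 \<partial>\<zeta>) + (\<integral>x. (f x)\<^sup>2 \<partial>\<zeta>)"
      using L2_mult[OF gL fL] gL fL by (simp add: L2_def)
    moreover have "(h x)\<^sup>2 = (?g x)\<^sup>2 + 2 * (?g x * f x) + (f x)\<^sup>2" for x
      by (simp add: power2_eq_square algebra_simps)
    ultimately have "(\<integral>x. (h x)\<^sup>2 \<partial>\<zeta>) = (\<integral>x. (?g x)\<^sup>2 \<partial>\<zeta>) + (\<integral>x. (f x)\<^sup>2 \<partial>\<zeta>)" by presburger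
    then have "spline_functional q \<zeta> v = spline_functional q \<zeta> u + (\<integral>x. (?g x)\<^sup>2 \<partial>\<zeta>)"
      by (simp add: spline_functional_eq[OF h] spline_functional_eq[OF ul])
    then show ?thesis using gL form by blast
  qed
  show ?thesis
  proof (rule ex1I[of _ u])
    have "spline_functional q \<zeta> u \<le> spline_functional q \<zeta> v" if "v \<in> Y" for v
      using key[OF that] by fastforce
    then show "u \<in> Y \<and> (\<forall>v\<in>Y. spline_functional q \<zeta> u \<le> spline_functional q \<zeta> v)" using uY by blast
    fix v assume v: "v \<in> Y \<and> (\<forall>v'\<in>Y. spline_functional q \<zeta> v \<le> spline_functional q \<zeta> v')"
    then obtain g where g: "L2 g"
      "\<And>\<phi>. \<phi> \<in> W0 \<Longrightarrow> energy_form q (\<lambda>x. v x - u x) \<phi> = - (\<integral>x. g x * \<phi> x \<partial>\<zeta>)"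
      "spline_functional q \<zeta> v = spline_functional q \<zeta> u + (\<integral>x. (g x)\<^sup>2 \<partial>\<zeta>)"
      using key[of v] by blast
    have "(\<integral>x. (g x)\<^sup>2 \<partial>\<zeta>) \<le> 0" using g(3) v uY by fastforce
    then have "(\<integral>x. (g x)\<^sup>2 \<partial>\<zeta>) = 0" by (intro antisym) auto
    then have "AE x in \<zeta>. (g x)\<^sup>2 = 0"
      using g(1) by (subst (asm) integral_nonneg_eq_0_iff_AE) (auto simp: L2_def)
    then have ae: "AE x in \<zeta>. g x = 0" by simp
    let ?w = "\<lambda>x. v x - u x"
    have vW: "v \<in> W" and vE: "v \<in> extensional K"
      using v unfolding Y dom_laplacian_def dom_energy_iff W_def by auto
    have wW: "?w \<in> W" by (rule W_diff[OF vW uW])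
    have "energy_form q ?w \<phi> = 0" if \<phi>: "\<phi> \<in> W0" for \<phi>
    proof -
      have "AE x in \<zeta>. g x * \<phi> x = 0" using ae by eventually_elim simp
      then have "(\<integral>x. g x * \<phi> x \<partial>\<zeta>) = 0" by (rule integral_eq_zero_AE)
      then show ?thesis using g(2)[OF \<phi>] by simp
    qed
    then have harm: "?w x = harmonic_part ?w x" if "x \<in> K" for x
      by (rule orthogonal_imp_harmonic[OF wW _ that])
    \<comment> \<open>The difference of two minimizers is the harmonic combination whose
      coefficients are its own vertex values; vanishing on \<open>E\<close> makes \<open>uni\<close>
      applicable.\<close>
    have "?w (q j) = 0" if "j < 3" for j
    proof (rule uni[OF _ that])
      fix p assume p: "p \<in> E"
      then have "?w p = 0" using v uY by (simp add: Y)
      then show "(\<Sum>j<3. ?w (q j) * harmonic_basis q j p) = 0"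
        using harm[of p] EK p by (auto simp: harmonic_part_def)
    qed
    then have "?w x = 0" if "x \<in> K" for x
      using harm[OF that] by (simp add: harmonic_part_def)
    then have vu: "v x = u x" if "x \<in> K" for x using that by fastforce
    have "u \<in> extensional K" by (simp add: u_def)
    then show "v = u" by (rule extensionalityI[OF vE]) (rule vu)
  qed
qed

end

lemma harmonic_matrix_unisolvent:
  assumes inv: "invertible (harmonic_matrix q x)"
    and c: "\<And>i. i \<in> {1, 2, 3} \<Longrightarrow> (\<Sum>j<3. c j * harmonic_basis q j (x i)) = 0" and j: "j < 3"
  shows "c j = 0"
proof -
  define y :: "real^3" where "y = vector [c 0, c 1, c 2]"
  have "harmonic_matrix q x *v y = 0"
    using c[of 1] c[of 2] c[of 3]
    by (simp add: vec_eq_iff forall_3 matrix_vector_mult_def sum_3 harmonic_matrix_def vector_3 y_def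
        lessThan_3 algebra_simps)
  then have "y = 0" using inv by (metis invertible_def matrix_left_invertible_ker)
  then have "c 0 = 0" "c 1 = 0" "c 2 = 0" by (simp_all add: y_def vec_eq_iff forall_3 vector_3)
  moreover have "j \<in> {0, 1, 2}" using j by auto
  ultimately show ?thesis by auto
qed

theorem theorem3p1:
  fixes q :: "nat \<Rightarrow> real^2" and \<zeta> :: "(real^2) measure"
    and m n :: nat and x :: "nat \<Rightarrow> real^2" and a :: "nat \<Rightarrow> real"
  assumes "equilateral q"
    and "finite_positive_continuous_measure q \<zeta>"
    and "n \<ge> 3" and "inj_on x {1..n}" and "x ` {1..n} \<subseteq> sg_V q m"
    and "invertible (harmonic_matrix q x)"
  shows "\<exists>!u. u \<in> interpolants q \<zeta> n x a \<and>
           (\<forall>v\<in>interpolants q \<zeta> n x a. spline_functional q \<zeta> u \<le> spline_functional q \<zeta> v)"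
proof -
  interpret gasket_measure q \<zeta>
    by standard (fact assms(1), fact assms(2))
  show ?thesis
  proof (rule unique_minimizer[OF _ assms(5)])
    show "c j = 0" if "\<And>p. p \<in> x ` {1..n} \<Longrightarrow> (\<Sum>j<3. c j * harmonic_basis q j p) = 0" "j < 3" for c j
      by (rule harmonic_matrix_unisolvent[OF assms(6) _ that(2)]) (use that(1) assms(3) in auto)
    \<comment> \<open>Since the points are distinct, the data indexed by \<open>i\<close> become a
      function of the point.\<close>
    show "interpolants q \<zeta> n x a
        = {u \<in> dom_laplacian q \<zeta>. \<forall>p\<in>x ` {1..n}. u p = a (inv_into {1..n} x p)}"
      using inv_into_f_f[OF assms(4)] unfolding interpolants_def by auto
  qed simp
qed

end
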